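(* Let $d\ge 2$ and $n\ge 1$ be integers. Let $Z_d(n)$ be the number of equivalence classes of $d$-tuples $(\sigma_1,\dots,\sigma_d)\in (S_n)^{\times d}$ under the relation $$(\sigma_1,\dots,\sigma_d)\sim(\gamma_1\sigma_1\gamma_2,\dots,\gamma_1\sigma_d\gamma_2),\qquad \gamma_1,\gamma_2\in S_n,$$ i.e. the cardinality of the double coset space $\mathrm{Diag}(S_n)\backslash (S_n)^{\times d}/\mathrm{Diag}(S_n)$. Then $$Z_d(n)=\sum_{p\vdash n}\big(\mathrm{Sym}(p)\big)^{d-2}.$$ Moreover, if $N>n$ and $V_1,\dots,V_d$ are the fundamental representations of the $d$ factors of $U(N)^{\times d}$, then $Z_d(n)$ equals the dimension of the space of $U(N)^{\times d}$-invariants in $W\otimes\bar W$, where $W=\mathrm{Sym}^n(V_1\otimes\cdots\otimes V_d)$ and $\bar W=\mathrm{Sym}^n(\bar V_1\otimes\cdots\otimes\bar V_d)$.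
   Context: $S_n$ is the symmetric group on $\{1,\dots,n\}$ and $\mathrm{Diag}(S_n)=\{(\gamma,\dots,\gamma)\}\subset (S_n)^{\times d}$. A partition $p\vdash n$ is written $p=(p_1,\dots,p_n)$, where $p_i\ge 0$ is the number of parts equal to $i$, so $\sum_i i p_i=n$; $\mathrm{Sym}(p)=\prod_{i=1}^n i^{p_i}\,p_i!$. $\mathrm{Sym}^n(U)$ denotes the symmetric part of $U^{\otimes n}$ (symmetrization over the $n$ tensor copies). $V_a\cong\mathbb{C}^N$ is the representation of $U(N)^{\times d}$ in which the $a$-th factor acts by the fundamental representation and the other factors act trivially; $\bar V_a$ is its complex conjugate. *)

theory Defs
  imports
    "HOL-Analysis.Analysis"
    "HOL-Combinatorics.Permutations"
    "HOL-Library.Function_Algebras"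
    "HOL-Library.FuncSet"
    "Jordan_Normal_Form.Schur_Decomposition"
begin

section \<open>Double cosets of the diagonal symmetric group\<close>

definition perm_tuples :: "nat \<Rightarrow> nat \<Rightarrow> (nat \<Rightarrow> nat \<Rightarrow> nat) set" where
  "perm_tuples d n = {1..d} \<rightarrow>\<^sub>E {\<sigma>. \<sigma> permutes {1..n}}"

definition diag_rel :: "nat \<Rightarrow> nat \<Rightarrow> ((nat \<Rightarrow> nat \<Rightarrow> nat) \<times> (nat \<Rightarrow> nat \<Rightarrow> nat)) set" where
  "diag_rel d n = {(\<sigma>, \<tau>). \<sigma> \<in> perm_tuples d n \<and> \<tau> \<in> perm_tuples d n \<and>
     (\<exists>\<gamma>1 \<gamma>2. \<gamma>1 permutes {1..n} \<and> \<gamma>2 permutes {1..n} \<and>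
        (\<forall>a\<in>{1..d}. \<tau> a = \<gamma>1 \<circ> \<sigma> a \<circ> \<gamma>2))}"

definition Z_count :: "nat \<Rightarrow> nat \<Rightarrow> nat" where
  "Z_count d n = card (perm_tuples d n // diag_rel d n)"

lemma equiv_diag_rel: "equiv (perm_tuples d n) (diag_rel d n)"
proof (rule equivI)
  show "diag_rel d n \<subseteq> perm_tuples d n \<times> perm_tuples d n"
    by (auto simp: diag_rel_def)
  show "refl_on (perm_tuples d n) (diag_rel d n)"
    unfolding refl_on_def diag_rel_def
    by (auto intro!: exI[of _ id] permutes_id)
  show "sym (diag_rel d n)"
  proof (rule symI)
    fix \<sigma> \<tau> assume "(\<sigma>, \<tau>) \<in> diag_rel d n"
    then obtain g h where *: "\<sigma> \<in> perm_tuples d n" "\<tau> \<in> perm_tuples d n"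
      "g permutes {1..n}" "h permutes {1..n}" "\<And>a. a \<in> {1..d} \<Longrightarrow> \<tau> a = g \<circ> \<sigma> a \<circ> h"
      unfolding diag_rel_def by blast
    have "\<sigma> a = inv_into UNIV g \<circ> \<tau> a \<circ> inv_into UNIV h" if "a \<in> {1..d}" for a
      using *(5)[OF that] permutes_inverses[OF *(3)] permutes_inverses[OF *(4)]
      by (auto simp: fun_eq_iff)
    then show "(\<tau>, \<sigma>) \<in> diag_rel d n"
      unfolding diag_rel_def using * permutes_inv[OF *(3)] permutes_inv[OF *(4)] by blast
  qed
  show "trans (diag_rel d n)"
  proof (rule transI)
    fix \<sigma> \<tau> \<rho> assume "(\<sigma>, \<tau>) \<in> diag_rel d n" "(\<tau>, \<rho>) \<in> diag_rel d n"
    then obtain g h g' h' where *: "\<sigma> \<in> perm_tuples d n" "\<rho> \<in> perm_tuples d n"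
      "g permutes {1..n}" "h permutes {1..n}" "g' permutes {1..n}" "h' permutes {1..n}"
      "\<And>a. a \<in> {1..d} \<Longrightarrow> \<tau> a = g \<circ> \<sigma> a \<circ> h" "\<And>a. a \<in> {1..d} \<Longrightarrow> \<rho> a = g' \<circ> \<tau> a \<circ> h'"
      unfolding diag_rel_def by blast
    have "\<rho> a = (g' \<circ> g) \<circ> \<sigma> a \<circ> (h \<circ> h')" if "a \<in> {1..d}" for a
      using *(7,8)[OF that] by (simp add: comp_assoc)
    then show "(\<sigma>, \<rho>) \<in> diag_rel d n"
      unfolding diag_rel_def
      using * permutes_compose[OF *(3,5)] permutes_compose[OF *(6,4)] by blast
  qed
qed

lemma finite_perm_tuples: "finite (perm_tuples d n)"
  unfolding perm_tuples_def by (intro finite_PiE) (auto intro: finite_permutations)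


section \<open>Partitions in multiplicity form\<close>

text \<open>\<open>p i\<close> is the number of parts equal to \<open>i\<close>; the values outside \<open>{1..n}\<close> are pinned to
  \<open>0\<close> so that a partition is represented by exactly one function.\<close>

definition partitions :: "nat \<Rightarrow> (nat \<Rightarrow> nat) set" where
  "partitions n = {p. (\<forall>i. i \<notin> {1..n} \<longrightarrow> p i = 0) \<and> (\<Sum>i = 1..n. i * p i) = n}"

definition Sym :: "nat \<Rightarrow> (nat \<Rightarrow> nat) \<Rightarrow> nat" where
  "Sym n p = (\<Prod>i = 1..n. i ^ p i * fact (p i))"

lemma finite_partitions: "finite (partitions n)"
proof (rule finite_subset)
  show "partitions n \<subseteq> {p. (\<forall>i\<in>{1..n}. p i \<in> {..n}) \<and> (\<forall>i. i \<notin> {1..n} \<longrightarrow> p i = 0)}"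
  proof safe
    fix p i assume p: "p \<in> partitions n" and i: "i \<in> {1..n}"
    have "p i \<le> i * p i" using i by simp
    also have "\<dots> \<le> (\<Sum>i = 1..n. i * p i)" using i by (intro member_le_sum) auto
    finally show "p i \<le> n" using p by (simp add: partitions_def)
  qed (auto simp: partitions_def)
  show "finite {p. (\<forall>i\<in>{1..n}. p i \<in> {..n}) \<and> (\<forall>i. i \<notin> {1..n} \<longrightarrow> p i = (0::nat))}"
    by (rule finite_subset[OF _ finite_set_of_finite_funs[of "{1..n}" "{..n}" 0]]) auto
qed


section \<open>Complex coordinate spaces and tensor products\<close>

text \<open>The space with basis indexed by \<open>I\<close> is realised as the functions vanishing outside \<open>I\<close>.
  Dimension and span are those of the complex vector space of all functions.\<close>

definition cscale :: "complex \<Rightarrow> ('i \<Rightarrow> complex) \<Rightarrow> ('i \<Rightarrow> complex)" where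
  "cscale c x = (\<lambda>i. c * x i)"

interpretation cvec: vector_space "cscale :: complex \<Rightarrow> ('i \<Rightarrow> complex) \<Rightarrow> ('i \<Rightarrow> complex)"
  by standard (auto simp: cscale_def fun_eq_iff algebra_simps)

definition coord_space :: "'i set \<Rightarrow> ('i \<Rightarrow> complex) set" where
  "coord_space I = {x. \<forall>i. i \<notin> I \<longrightarrow> x i = 0}"

definition op_apply :: "'i set \<Rightarrow> ('i \<Rightarrow> 'i \<Rightarrow> complex) \<Rightarrow> ('i \<Rightarrow> complex) \<Rightarrow> ('i \<Rightarrow> complex)" where
  "op_apply I A x = (\<lambda>i. if i \<in> I then \<Sum>j\<in>I. A i j * x j else 0)"

text \<open>The tensor product over \<open>k \<in> K\<close> of the spaces with bases indexed by \<open>I k\<close> has its basis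
  indexed by \<open>Pi\<^sub>E K I\<close>, the tensor product of operators being the Kronecker product.\<close>

definition tensor_vec :: "'k set \<Rightarrow> ('k \<Rightarrow> 'i set) \<Rightarrow> ('k \<Rightarrow> 'i \<Rightarrow> complex) \<Rightarrow> (('k \<Rightarrow> 'i) \<Rightarrow> complex)" where
  "tensor_vec K I x = (\<lambda>i. if i \<in> Pi\<^sub>E K I then \<Prod>k\<in>K. x k (i k) else 0)"

definition tensor_op :: "'k set \<Rightarrow> ('k \<Rightarrow> 'i \<Rightarrow> 'i \<Rightarrow> complex) \<Rightarrow> (('k \<Rightarrow> 'i) \<Rightarrow> ('k \<Rightarrow> 'i) \<Rightarrow> complex)" where
  "tensor_op K A = (\<lambda>i j. \<Prod>k\<in>K. A k (i k) (j k))"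

definition tensor_vec2 :: "('i \<Rightarrow> complex) \<Rightarrow> ('j \<Rightarrow> complex) \<Rightarrow> ('i \<times> 'j \<Rightarrow> complex)" where
  "tensor_vec2 x y = (\<lambda>(i, j). x i * y j)"

definition tensor_op2 ::
  "('i \<Rightarrow> 'i \<Rightarrow> complex) \<Rightarrow> ('j \<Rightarrow> 'j \<Rightarrow> complex) \<Rightarrow> ('i \<times> 'j \<Rightarrow> 'i \<times> 'j \<Rightarrow> complex)" where
  "tensor_op2 A B = (\<lambda>(i, j) (i', j'). A i i' * B j j')"

definition tensor_subspaces ::
  "('i \<Rightarrow> complex) set \<Rightarrow> ('j \<Rightarrow> complex) set \<Rightarrow> ('i \<times> 'j \<Rightarrow> complex) set" where
  "tensor_subspaces X Y = cvec.span {tensor_vec2 x y | x y. x \<in> X \<and> y \<in> Y}"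

lemma op_apply_tensor_vec:
  assumes "finite K" "\<And>k. k \<in> K \<Longrightarrow> finite (I k)"
  shows "op_apply (Pi\<^sub>E K I) (tensor_op K A) (tensor_vec K I x) =
         tensor_vec K I (\<lambda>k. op_apply (I k) (A k) (x k))"
proof
  fix i
  have "(\<Sum>j\<in>Pi\<^sub>E K I. tensor_op K A i j * tensor_vec K I x j) =
        (\<Prod>k\<in>K. \<Sum>j\<in>I k. A k (i k) j * x k j)"
    by (subst prod_sum_PiE[OF assms])
       (auto simp: tensor_op_def tensor_vec_def prod.distrib intro!: sum.cong)
  moreover have "(\<Prod>k\<in>K. \<Sum>j\<in>I k. A k (i k) j * x k j) =
        (\<Prod>k\<in>K. op_apply (I k) (A k) (x k) (i k))" if "i \<in> Pi\<^sub>E K I"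
    using that by (auto simp: op_apply_def PiE_def Pi_def intro!: prod.cong)
  ultimately show "op_apply (Pi\<^sub>E K I) (tensor_op K A) (tensor_vec K I x) i =
         tensor_vec K I (\<lambda>k. op_apply (I k) (A k) (x k)) i"
    by (simp add: op_apply_def[of "Pi\<^sub>E K I"] tensor_vec_def[of K I "\<lambda>k. op_apply (I k) (A k) (x k)"])
qed

lemma op_apply_tensor_vec2:
  assumes "finite I" "finite J"
  shows "op_apply (I \<times> J) (tensor_op2 A B) (tensor_vec2 x y) =
         tensor_vec2 (op_apply I A x) (op_apply J B y)"
  using assms
  by (auto simp: fun_eq_iff op_apply_def tensor_op2_def tensor_vec2_def sum_product
      sum.cartesian_product intro!: sum.cong)


section \<open>Symmetric tensor powers\<close>

definition tpower_index :: "nat \<Rightarrow> 'i set \<Rightarrow> (nat \<Rightarrow> 'i) set" where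
  "tpower_index n I = {1..n} \<rightarrow>\<^sub>E I"

definition symmetrize :: "nat \<Rightarrow> ((nat \<Rightarrow> 'i) \<Rightarrow> complex) \<Rightarrow> ((nat \<Rightarrow> 'i) \<Rightarrow> complex)" where
  "symmetrize n T = (\<lambda>i. (\<Sum>\<pi> | \<pi> permutes {1..n}. T (i \<circ> \<pi>)) / fact n)"

definition sym_power :: "nat \<Rightarrow> 'i set \<Rightarrow> ((nat \<Rightarrow> 'i) \<Rightarrow> complex) set" where
  "sym_power n I = symmetrize n ` coord_space (tpower_index n I)"

lemma tpower_index_comp:
  assumes "\<pi> permutes {1..n}"
  shows "i \<circ> \<pi> \<in> tpower_index n I \<longleftrightarrow> i \<in> tpower_index n I"
proof -
  have *: "i \<circ> \<pi> \<in> tpower_index n I" if "i \<in> tpower_index n I" "\<pi> permutes {1..n}"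
    for i :: "nat \<Rightarrow> 'a" and \<pi>
  proof -
    have "\<pi> k \<in> {1..n} \<longleftrightarrow> k \<in> {1..n}" for k
      using permutes_in_image[OF that(2)] by blast
    then show ?thesis
      using that(1) by (auto simp: tpower_index_def PiE_def Pi_def extensional_def)
  qed
  have "i = (i \<circ> \<pi>) \<circ> inv_into UNIV \<pi>"
    using permutes_inverses[OF assms] by (auto simp: fun_eq_iff)
  then show ?thesis
    using *[of i \<pi>] *[of "i \<circ> \<pi>" "inv_into UNIV \<pi>"] assms permutes_inv[OF assms] by metis
qed

lemma mem_sym_power_iff:
  "T \<in> sym_power n I \<longleftrightarrow> T \<in> coord_space (tpower_index n I) \<and>
     (\<forall>\<pi>. \<pi> permutes {1..n} \<longrightarrow> (\<forall>i. T (i \<circ> \<pi>) = T i))" (is "?L \<longleftrightarrow> ?R")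
proof
  assume ?L
  then obtain S where S: "S \<in> coord_space (tpower_index n I)" and T: "T = symmetrize n S"
    by (auto simp: sym_power_def)
  have "T \<in> coord_space (tpower_index n I)"
    using S by (auto simp: T coord_space_def symmetrize_def tpower_index_comp intro!: sum.neutral)
  moreover have "T (i \<circ> \<pi>) = T i" if "\<pi> permutes {1..n}" for \<pi> i
    unfolding T symmetrize_def
    using setum_permutations_compose_left[OF that, of "\<lambda>\<rho>. S (i \<circ> \<rho>)"]
    by (simp add: comp_assoc)
  ultimately show ?R by blast
next
  assume R: ?R
  then have "symmetrize n T = T"
    by (auto simp: symmetrize_def fun_eq_iff card_permutations[OF refl])
  then show ?L using R unfolding sym_power_def by (metis imageI)
qed


section \<open>The representations of \<open>U(N)\<^sup>d\<close>\<close>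

definition unitary_group :: "nat \<Rightarrow> complex mat set" where
  "unitary_group N = {A \<in> carrier_mat N N. A * mat_adjoint A = 1\<^sub>m N \<and> mat_adjoint A * A = 1\<^sub>m N}"

definition unitary_tuples :: "nat \<Rightarrow> nat \<Rightarrow> (nat \<Rightarrow> complex mat) set" where
  "unitary_tuples d N = {1..d} \<rightarrow>\<^sub>E unitary_group N"

text \<open>For \<open>g\<close> in \<open>U(N)\<^sup>d\<close>, \<open>fund_op g a\<close> and \<open>conj_op g a\<close> are its actions on \<open>V\<^sub>a\<close> and on the
  complex conjugate of \<open>V\<^sub>a\<close>.\<close>

definition fund_op :: "(nat \<Rightarrow> complex mat) \<Rightarrow> nat \<Rightarrow> nat \<Rightarrow> nat \<Rightarrow> complex" where
  "fund_op g a = (\<lambda>i j. g a $$ (i, j))"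

definition conj_op :: "(nat \<Rightarrow> complex mat) \<Rightarrow> nat \<Rightarrow> nat \<Rightarrow> nat \<Rightarrow> complex" where
  "conj_op g a = (\<lambda>i j. cnj (g a $$ (i, j)))"

text \<open>\<open>U_index d N\<close> indexes the basis of \<open>V\<^sub>1 \<otimes> \<dots> \<otimes> V\<^sub>d\<close>, and equally that of the tensor product of
  the conjugates; as spaces of coefficients \<open>W\<close> and its conjugate coincide, and only the actions
  differ.\<close>

definition U_index :: "nat \<Rightarrow> nat \<Rightarrow> (nat \<Rightarrow> nat) set" where
  "U_index d N = {1..d} \<rightarrow>\<^sub>E {..<N}"

definition W_space :: "nat \<Rightarrow> nat \<Rightarrow> nat \<Rightarrow> ((nat \<Rightarrow> nat \<Rightarrow> nat) \<Rightarrow> complex) set" where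
  "W_space d n N = sym_power n (U_index d N)"

definition W_op :: "nat \<Rightarrow> nat \<Rightarrow> (nat \<Rightarrow> complex mat) \<Rightarrow>
    (nat \<Rightarrow> nat \<Rightarrow> nat) \<Rightarrow> (nat \<Rightarrow> nat \<Rightarrow> nat) \<Rightarrow> complex" where
  "W_op d n g = tensor_op {1..n} (\<lambda>_. tensor_op {1..d} (fund_op g))"

definition Wbar_op :: "nat \<Rightarrow> nat \<Rightarrow> (nat \<Rightarrow> complex mat) \<Rightarrow>
    (nat \<Rightarrow> nat \<Rightarrow> nat) \<Rightarrow> (nat \<Rightarrow> nat \<Rightarrow> nat) \<Rightarrow> complex" where
  "Wbar_op d n g = tensor_op {1..n} (\<lambda>_. tensor_op {1..d} (conj_op g))"

definition WWbar_invariants :: "nat \<Rightarrow> nat \<Rightarrow> nat \<Rightarrow>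
    ((nat \<Rightarrow> nat \<Rightarrow> nat) \<times> (nat \<Rightarrow> nat \<Rightarrow> nat) \<Rightarrow> complex) set" where
  "WWbar_invariants d n N =
     {T \<in> tensor_subspaces (W_space d n N) (W_space d n N).
        \<forall>g\<in>unitary_tuples d N.
          op_apply (tpower_index n (U_index d N) \<times> tpower_index n (U_index d N))
            (tensor_op2 (W_op d n g) (Wbar_op d n g)) T = T}"

end

theory Submission
  imports Defs
begin

text \<open>Burnside's lemma for \<open>S\<^sub>n \<times> S\<^sub>n\<close> acting on \<open>d\<close>-tuples reduces the count to the numbers of \<open>s\<close> with
  \<open>s \<circ> h = g \<circ> s\<close>. Such an \<open>s\<close> exists only if \<open>g\<close> and \<open>h\<close> have the same cycle type \<open>p\<close>; sending a chosen
  point of an \<open>i\<close>-cycle of \<open>h\<close> to any of the \<open>i p\<^sub>i\<close> points of \<open>i\<close>-cycles of \<open>g\<close> determines \<open>s\<close> on that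
  cycle, and removing the two cycles gives \<open>Sym p\<close> solutions by induction.

  For the dimension, an invariant tensor is read as an operator \<open>T\<close> on the tensor space commuting with
  \<open>g\<^sup>\<otimes>\<close> for all tuples \<open>g\<close> of unitary matrices. The torus forces \<open>T\<close> to preserve the content of an index,
  so \<open>T\<close> commutes with all diagonal matrices, and hence, since the singular map merging two basis vectors
  is a diagonal matrix times a unitary one, also with such mergings. Permutations and mergings carry one
  basis vector with pairwise distinct entries (it exists as \<open>n \<le> N\<close>) to every basis vector, so \<open>T\<close> is
  determined by a single column, that is, by one coefficient for each \<open>d\<close>-tuple of permutations. The
  symmetry in the two groups of \<open>n\<close> tensor factors says that this coefficient is constant on double
  cosets.\<close>

section \<open>Bijections intertwining two permutations\<close>

text \<open>Only forward iterates are taken: a bijection of a finite set returns every point to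
  itself, so they run through the whole cycle.\<close>

definition orb :: "('a \<Rightarrow> 'a) \<Rightarrow> 'a \<Rightarrow> 'a set" where
  "orb f x = range (\<lambda>k. (f ^^ k) x)"

lemma funpow_mem: "bij_betw f A A \<Longrightarrow> x \<in> A \<Longrightarrow> (f ^^ k) x \<in> A"
  by (induction k) (auto dest: bij_betwE)

lemma funpow_cancel:
  assumes "bij_betw f A A" "x \<in> A" "y \<in> A" "(f ^^ k) x = (f ^^ k) y"
  shows "x = y"
  using assms bij_betw_imp_inj_on[OF bij_betw_funpow[OF assms(1), of k]] by (auto dest: inj_onD)

lemma funpow_diff_fixed:
  assumes "bij_betw f A A" "x \<in> A" "(f ^^ k) x = (f ^^ l) x" "k \<le> l"
  shows "(f ^^ (l - k)) x = x"
proof (rule funpow_cancel[OF assms(1) _ assms(2), where k = k])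
  show "(f ^^ (l - k)) x \<in> A" using assms by (simp add: funpow_mem)
  have "(f ^^ k) ((f ^^ (l - k)) x) = (f ^^ (k + (l - k))) x"
    unfolding funpow_add comp_def ..
  then show "(f ^^ k) ((f ^^ (l - k)) x) = (f ^^ k) x"
    using assms by simp
qed

text \<open>By pigeonhole two iterates of \<open>x\<close> agree, and cancelling gives a return to
  \<open>x\<close>. Before the least return time \<open>m\<close> the iterates are distinct, and
  from then on they repeat, so \<open>m\<close> is the size of the orbit and equality of iterates is
  congruence modulo \<open>m\<close>.\<close>

lemma orb_period:
  assumes "finite A" "bij_betw f A A" "x \<in> A"
  defines "c \<equiv> card (orb f x)"
  shows "c > 0" and "orb f x \<subseteq> A"
    and "(f ^^ k) x = (f ^^ l) x \<longleftrightarrow> k mod c = l mod c"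
proof -
  show sub: "orb f x \<subseteq> A" using funpow_mem[OF assms(2,3)] by (auto simp: orb_def)
  then have fin: "finite (orb f x)" using assms(1) finite_subset by blast
  then have "\<not> inj (\<lambda>k. (f ^^ k) x)"
    unfolding orb_def using finite_imageD infinite_UNIV_nat by blast
  then obtain k0 l0 where kl: "k0 < l0" "(f ^^ k0) x = (f ^^ l0) x"
    unfolding inj_def by (metis linorder_neqE_nat)
  have ex: "\<exists>m. m > 0 \<and> (f ^^ m) x = x"
    using funpow_diff_fixed[OF assms(2,3) kl(2)] kl(1) by (intro exI[of _ "l0 - k0"]) auto
  define m where "m = (LEAST m. m > 0 \<and> (f ^^ m) x = x)"
  have m: "m > 0" "(f ^^ m) x = x" unfolding m_def using LeastI_ex[OF ex] by auto
  have least: "m \<le> m'" if "m' > 0" "(f ^^ m') x = x" for m'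
    unfolding m_def using that by (intro Least_le) auto
  have lt: "k = l" if "k \<le> l" "l < m" "(f ^^ k) x = (f ^^ l) x" for k l
    using least[OF _ funpow_diff_fixed[OF assms(2,3) that(3,1)]] that by fastforce
  have inj: "inj_on (\<lambda>k. (f ^^ k) x) {..<m}"
    by (rule inj_onI) (metis lt lessThan_iff nat_le_linear)
  have "orb f x = (\<lambda>k. (f ^^ k) x) ` {..<m}"
  proof
    show "orb f x \<subseteq> (\<lambda>k. (f ^^ k) x) ` {..<m}"
      unfolding orb_def using funpow_mod_eq[OF m(2)] m(1)
      by (metis (no_types, lifting) imageI image_subsetI lessThan_iff mod_less_divisor)
  qed (auto simp: orb_def)
  then have "c = m" unfolding c_def using card_image[OF inj] by simp
  then show "c > 0" using m by simp
  have "(f ^^ k) x = (f ^^ (k mod m)) x" "(f ^^ l) x = (f ^^ (l mod m)) x"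
    using funpow_mod_eq[OF m(2)] by metis+
  moreover have "(f ^^ (k mod m)) x = (f ^^ (l mod m)) x \<longleftrightarrow> k mod m = l mod m"
    using inj m(1) by (auto simp: inj_on_def)
  ultimately show "(f ^^ k) x = (f ^^ l) x \<longleftrightarrow> k mod c = l mod c"
    using \<open>c = m\<close> by simp
qed

lemma self_in_orb: "x \<in> orb f x"
  unfolding orb_def by (metis funpow_0 rangeI)

lemma orb_step: "y \<in> orb f x \<Longrightarrow> f y \<in> orb f x"
proof -
  assume "y \<in> orb f x"
  then obtain k where "y = (f ^^ k) x" by (auto simp: orb_def)
  then have "f y = (f ^^ Suc k) x" by simp
  then show ?thesis unfolding orb_def by (rule range_eqI)
qed

lemma orb_eq:
  assumes "finite A" "bij_betw f A A" "x \<in> A" "y \<in> orb f x"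
  shows "orb f y = orb f x"
proof -
  have trans: "orb f v \<subseteq> orb f u" if "v \<in> orb f u" for u v :: 'a
    using that by (auto simp: orb_def) (metis funpow_add o_apply rangeI)
  obtain k where k: "y = (f ^^ k) x" using assms(4) by (auto simp: orb_def)
  define c where "c = card (orb f x)"
  \<comment> \<open>\<open>k * c\<close> is a multiple of the period and at least \<open>k\<close>;
    the remaining \<open>k * c - k\<close> steps lead from \<open>y\<close> back to \<open>x\<close>
    without an inverse of \<open>f\<close>.\<close>
  have "(f ^^ (k * c - k)) y = (f ^^ (k * c)) x"
  proof -
    have "k \<le> k * c" using orb_period(1)[OF assms(1-3)] by (simp add: c_def)
    then have "(k * c - k) + k = k * c" by simp
    then show ?thesis unfolding k by (metis funpow_add o_apply)
  qed
  also have "\<dots> = x"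
    using orb_period(3)[OF assms(1-3), of "k * c" 0] by (simp add: c_def)
  finally have "x \<in> orb f y" unfolding orb_def by (metis rangeI)
  with trans assms(4) show ?thesis by blast
qed

lemma bij_betw_Diff_orb:
  assumes "finite A" "bij_betw f A A" "x \<in> A"
  shows "bij_betw f (A - orb f x) (A - orb f x)"
proof -
  have sub: "orb f x \<subseteq> A" by (rule orb_period(2)[OF assms])
  have "f ` orb f x \<subseteq> orb f x" by (auto intro: orb_step)
  moreover have inj: "inj_on f (orb f x)"
    using assms(2) sub by (meson bij_betw_def inj_on_subset)
  ultimately have "f ` orb f x = orb f x"
    using sub assms(1) by (meson card_image card_subset_eq finite_subset)
  then have "bij_betw f (orb f x) (orb f x)" using inj by (simp add: bij_betw_def)
  then show ?thesis by (rule bij_betw_DiffI[OF assms(2) _ sub sub])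
qed

text \<open>Points are counted rather than cycles: the value is \<open>i\<close> times the number of
  \<open>i\<close>-cycles, which is the number of possible images of a base point on an
  \<open>i\<close>-cycle.\<close>

definition orb_count :: "('a \<Rightarrow> 'a) \<Rightarrow> 'a set \<Rightarrow> nat \<Rightarrow> nat" where
  "orb_count f A i = card {x\<in>A. card (orb f x) = i}"

text \<open>\<open>orb\<close> does not refer to \<open>A\<close>, so removing one whole orbit
  leaves the lengths of the others unchanged. This drives the inductions on
  \<open>card A\<close>.\<close>

lemma orb_count_Diff:
  assumes "finite A" "bij_betw f A A" "x \<in> A"
  shows "orb_count f A i = orb_count f (A - orb f x) i + (if i = card (orb f x) then i else 0)"
proof -
  have sub: "orb f x \<subseteq> A" by (rule orb_period(2)[OF assms])
  have "{y\<in>A. card (orb f y) = i} =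
      {y\<in>A - orb f x. card (orb f y) = i} \<union> (if i = card (orb f x) then orb f x else {})"
  proof -
    have "card (orb f y) = card (orb f x)" if "y \<in> orb f x" for y
      using orb_eq[OF assms that] by simp
    then show ?thesis using sub by (auto split: if_splits)
  qed
  also have "card \<dots> = card {y\<in>A - orb f x. card (orb f y) = i}
       + card (if i = card (orb f x) then orb f x else {})"
    by (rule card_Un_disjoint) (use assms(1) finite_subset[OF sub assms(1)] in auto)
  finally show ?thesis unfolding orb_count_def by simp
qed

text \<open>Removing orbits one at a time lowers the count by \<open>i\<close> or by
  \<open>0\<close>. It makes the division in \<open>cycle_type\<close> exact.\<close>

lemma dvd_orb_count:
  assumes "finite A" "bij_betw f A A"
  shows "i dvd orb_count f A i"
  using assms
proof (induction "card A" arbitrary: A rule: less_induct)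
  case less
  show ?case
  proof (cases "A = {}")
    case False
    then obtain x where x: "x \<in> A" by blast
    have "card (A - orb f x) < card A"
      using less.prems(1) x self_in_orb[of x f] by (intro psubset_card_mono) auto
    then have "i dvd orb_count f (A - orb f x) i"
      using less bij_betw_Diff_orb[OF less.prems x] by blast
    then show ?thesis using orb_count_Diff[OF less.prems x] by simp
  qed (simp add: orb_count_def)
qed

lemma sum_orb_count:
  assumes "finite A" "bij_betw f A A" "card A \<le> m"
  shows "(\<Sum>i = 1..m. orb_count f A i) = card A"
proof -
  have "A = (\<Union>i\<in>{1..m}. {x\<in>A. card (orb f x) = i})"
  proof -
    have "card (orb f x) \<in> {1..m}" if "x \<in> A" for x
      using orb_period(1)[OF assms(1,2) that] card_mono[OF assms(1) orb_period(2)[OF assms(1,2) that]]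
        assms(3) by simp
    then show ?thesis by auto
  qed
  then have "card A = card (\<Union>i\<in>{1..m}. {x\<in>A. card (orb f x) = i})" by simp
  also have "\<dots> = (\<Sum>i = 1..m. orb_count f A i)"
    unfolding orb_count_def by (rule card_UN_disjoint) (use assms(1) in auto)
  finally show ?thesis ..
qed

lemma orb_count_eq_0:
  assumes "finite A" "bij_betw f A A" "i \<notin> {1..card A}"
  shows "orb_count f A i = 0"
proof -
  have "card (orb f x) \<in> {1..card A}" if "x \<in> A" for x
    using orb_period(1)[OF assms(1,2) that] card_mono[OF assms(1) orb_period(2)[OF assms(1,2) that]]
    by simp
  then have "{x\<in>A. card (orb f x) = i} = {}" using assms(3) by auto
  then show ?thesis by (simp only: orb_count_def card.empty)
qed

text \<open>\<open>h\<close> carries the orbit of \<open>x\<close> bijectively onto that of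
  \<open>h x\<close>. This serves both for conjugate permutations and for moving a model permutation
  to \<open>{1..n}\<close>.\<close>

lemma orb_count_conj:
  assumes h: "bij_betw h A B" and f: "bij_betw f A A" and int: "\<And>x. x \<in> A \<Longrightarrow> h (f x) = g (h x)"
  shows "orb_count g B i = orb_count f A i"
proof -
  have pow: "h ((f ^^ k) x) = (g ^^ k) (h x)" if "x \<in> A" for x k
    by (induction k) (use int funpow_mem[OF f that] in auto)
  have card: "card (orb g (h x)) = card (orb f x)" if "x \<in> A" for x
  proof -
    have "orb g (h x) = h ` orb f x" unfolding orb_def using pow[OF that] by (auto simp: image_image)
    moreover have "inj_on h (orb f x)"
      by (rule inj_on_subset[OF bij_betw_imp_inj_on[OF h]]) (auto simp: orb_def funpow_mem[OF f that])
    ultimately show ?thesis by (simp add: card_image)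
  qed
  have "bij_betw h {x\<in>A. card (orb f x) = i} {y\<in>B. card (orb g y) = i}"
    unfolding bij_betw_def
  proof
    show "inj_on h {x\<in>A. card (orb f x) = i}"
      by (rule inj_on_subset[OF bij_betw_imp_inj_on[OF h]]) auto
    show "h ` {x\<in>A. card (orb f x) = i} = {y\<in>B. card (orb g y) = i}"
      using card bij_betw_imp_surj_on[OF h] by auto
  qed
  then show ?thesis unfolding orb_count_def by (simp add: bij_betw_same_card)
qed

section \<open>Counting intertwiners\<close>

text \<open>Source and target are separate sets because the induction removes a different cycle on
  each side; \<open>extensional\<close> makes a map determined by its values on
  \<open>A\<close>.\<close>

definition intertwiners :: "('a \<Rightarrow> 'a) \<Rightarrow> 'a set \<Rightarrow> ('b \<Rightarrow> 'b) \<Rightarrow> 'b set \<Rightarrow> ('a \<Rightarrow> 'b) set" where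
  "intertwiners f A g B =
     {h \<in> extensional A. bij_betw h A B \<and> (\<forall>x\<in>A. h (f x) = g (h x))}"

lemma finite_intertwiners:
  assumes "finite A" "finite B"
  shows "finite (intertwiners f A g B)"
  by (rule finite_subset[OF _ finite_PiE[of A "\<lambda>_. B"]])
     (use assms in \<open>auto simp: intertwiners_def PiE_def dest: bij_betwE\<close>)

lemma intertwiner_funpow:
  assumes "h \<in> intertwiners f A g B" "bij_betw f A A" "x \<in> A"
  shows "h ((f ^^ k) x) = (g ^^ k) (h x)"
  by (induction k) (use assms funpow_mem[OF assms(2,3)] in \<open>auto simp: intertwiners_def\<close>)

lemma intertwiner_card_orb:
  assumes "h \<in> intertwiners f A g B" "bij_betw f A A" "x \<in> A"
  shows "orb g (h x) = h ` orb f x" and "card (orb g (h x)) = card (orb f x)"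
proof -
  show eq: "orb g (h x) = h ` orb f x"
    unfolding orb_def using intertwiner_funpow[OF assms] by (auto simp: image_image)
  have "inj_on h (orb f x)"
    by (rule inj_on_subset[of h A])
       (use assms(1) in \<open>auto simp: intertwiners_def orb_def funpow_mem[OF assms(2,3)] dest: bij_betw_imp_inj_on\<close>)
  then show "card (orb g (h x)) = card (orb f x)" by (simp add: eq card_image)
qed

text \<open>Once \<open>x\<close> goes to \<open>y\<close>, the point \<open>(f ^^ k) x\<close> must
  go to \<open>(g ^^ k) y\<close>, so the map is forced on the orbit of \<open>x\<close> and
  arbitrary among the intertwiners of the complements.\<close>

lemma card_intertwiners_based:
  assumes A: "finite A" "bij_betw f A A" "x \<in> A"
    and B: "finite B" "bij_betw g B B" "y \<in> B"
    and c: "card (orb g y) = card (orb f x)"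
  shows "card {h \<in> intertwiners f A g B. h x = y} =
    card (intertwiners f (A - orb f x) g (B - orb g y))"
proof (rule bij_betw_same_card[of "\<lambda>h. restrict h (A - orb f x)"])
  let ?O = "orb f x" and ?P = "orb g y"
  have subO: "?O \<subseteq> A" and subP: "?P \<subseteq> B"
    using orb_period(2)[OF A] orb_period(2)[OF B] by auto
  have fO: "f z \<in> A - ?O" if "z \<in> A - ?O" for z
    using bij_betw_Diff_orb[OF A] that by (auto dest: bij_betwE)
  \<comment> \<open>Equal orbit sizes mean equal periods; this makes the assignment of
    \<open>(g ^^ k) y\<close> to \<open>(f ^^ k) x\<close> both well defined and injective.\<close>
  have same: "(f ^^ k) x = (f ^^ l) x \<longleftrightarrow> (g ^^ k) y = (g ^^ l) y" for k l
    using orb_period(3)[OF A] orb_period(3)[OF B] c by simp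
  show "bij_betw (\<lambda>h. restrict h (A - ?O)) {h \<in> intertwiners f A g B. h x = y}
     (intertwiners f (A - ?O) g (B - ?P))"
    unfolding bij_betw_def
  proof
    show "inj_on (\<lambda>h. restrict h (A - ?O)) {h \<in> intertwiners f A g B. h x = y}"
    proof (rule inj_onI)
      fix h h' assume h: "h \<in> {h \<in> intertwiners f A g B. h x = y}"
        and h': "h' \<in> {h \<in> intertwiners f A g B. h x = y}"
        and eq: "restrict h (A - ?O) = restrict h' (A - ?O)"
      show "h = h'"
      proof
        fix z
        consider "z \<in> ?O" | "z \<in> A - ?O" | "z \<notin> A" by blast
        then show "h z = h' z"
        proof cases
          case 1
          then obtain k where "z = (f ^^ k) x" by (auto simp: orb_def)
          then show ?thesis
            using h h' intertwiner_funpow[of h f A g B, OF _ A(2,3)]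
              intertwiner_funpow[of h' f A g B, OF _ A(2,3)] by auto
        next
          case 2
          then show ?thesis using fun_cong[OF eq, of z] by simp
        next
          case 3
          then show ?thesis using h h' by (auto simp: intertwiners_def extensional_def)
        qed
      qed
    qed
    show "(\<lambda>h. restrict h (A - ?O)) ` {h \<in> intertwiners f A g B. h x = y} =
      intertwiners f (A - ?O) g (B - ?P)"
    proof (intro equalityI subsetI)
      fix k assume "k \<in> (\<lambda>h. restrict h (A - ?O)) ` {h \<in> intertwiners f A g B. h x = y}"
      then obtain h where h: "h \<in> intertwiners f A g B" "h x = y" and k: "k = restrict h (A - ?O)"
        by auto
      have P: "h ` ?O = ?P" using intertwiner_card_orb(1)[OF h(1) A(2,3)] h(2) by simp
      have bij: "bij_betw h A B" and int: "\<forall>z\<in>A. h (f z) = g (h z)"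
        using h(1) by (auto simp: intertwiners_def)
      have "bij_betw h ?O ?P"
        using P inj_on_subset[OF bij_betw_imp_inj_on[OF bij] subO] by (simp add: bij_betw_def)
      then have "bij_betw h (A - ?O) (B - ?P)"
        by (rule bij_betw_DiffI[OF bij _ subO subP])
      then have "bij_betw k (A - ?O) (B - ?P)"
        by (rule bij_betw_cong[THEN iffD1, rotated]) (simp add: k)
      then show "k \<in> intertwiners f (A - ?O) g (B - ?P)"
        using int fO unfolding intertwiners_def k by auto
    next
      fix k assume k: "k \<in> intertwiners f (A - ?O) g (B - ?P)"
      \<comment> \<open>Any exponent reaching \<open>z\<close> will do: by \<open>same\<close> the
        value of \<open>h\<close> does not depend on the choice.\<close>
      define e where "e z = (SOME i. z = (f ^^ i) x)" for z
      define h where "h z = (if z \<in> A - ?O then k z else if z \<in> ?O then (g ^^ e z) y else undefined)" for z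
      have hO: "h ((f ^^ i) x) = (g ^^ i) y" for i
      proof -
        have "(f ^^ i) x = (f ^^ e ((f ^^ i) x)) x"
          unfolding e_def by (rule someI[of _ i]) simp
        then have "(g ^^ e ((f ^^ i) x)) y = (g ^^ i) y"
          unfolding same[symmetric] ..
        moreover have "(f ^^ i) x \<in> ?O" by (simp add: orb_def)
        ultimately show ?thesis by (simp add: h_def)
      qed
      have bij1: "bij_betw h ?O ?P"
        unfolding bij_betw_def
      proof
        show "inj_on h ?O" by (auto simp: inj_on_def orb_def hO same)
        show "h ` ?O = ?P" by (simp add: orb_def image_image hO)
      qed
      have "bij_betw k (A - ?O) (B - ?P)" using k by (simp add: intertwiners_def)
      then have bij2: "bij_betw h (A - ?O) (B - ?P)"
        by (rule bij_betw_cong[THEN iffD1, rotated]) (simp add: h_def)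
      have bij: "bij_betw h A B"
        using bij_betw_combine[OF bij1 bij2] subO subP by (simp add: Un_absorb1)
      have int: "h (f z) = g (h z)" if z: "z \<in> A" for z
      proof (cases "z \<in> ?O")
        case True
        then obtain i where i: "z = (f ^^ i) x" by (auto simp: orb_def)
        have "h (f z) = h ((f ^^ Suc i) x)" by (simp add: i)
        also have "\<dots> = g (h z)" unfolding i hO by simp
        finally show ?thesis .
      next
        case False
        then show ?thesis using z k fO[of z] by (simp add: h_def intertwiners_def)
      qed
      have "h x = y" using hO[of 0] by simp
      moreover have "h \<in> intertwiners f A g B"
        using bij int subO unfolding intertwiners_def by (auto simp: h_def extensional_def)
      moreover have "k = restrict h (A - ?O)"
        using k by (auto simp: h_def intertwiners_def extensional_def fun_eq_iff)
      ultimately show "k \<in> (\<lambda>h. restrict h (A - ?O)) ` {h \<in> intertwiners f A g B. h x = y}"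
        by blast
    qed
  qed
qed

text \<open>A base point on a \<open>c\<close>-cycle has \<open>c * p c\<close> possible images, and
  each choice leaves the same problem with \<open>p c\<close> lowered by one. The bound
  \<open>m\<close> stays fixed while \<open>A\<close> shrinks, so that the range of the product does
  not change in the induction.\<close>

lemma card_intertwiners:
  assumes "finite A" "bij_betw f A A" "finite B" "bij_betw g B B"
    and "\<And>i. orb_count f A i = i * p i" "\<And>i. orb_count g B i = i * p i" "card A \<le> m"
  shows "card (intertwiners f A g B) = (\<Prod>i = 1..m. i ^ p i * fact (p i))"
  using assms
proof (induction "card A" arbitrary: A B p rule: less_induct)
  case less
  note A = less.prems(1,2) and B = less.prems(3,4) and p = less.prems(5,6)
  show ?case
  proof (cases "A = {}")
    case True
    have 0: "i * p i = 0" for i using p(1)[of i] True by (simp add: orb_count_def)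
    have "card B = 0" using sum_orb_count[OF B order.refl] by (simp add: p(2) 0)
    then have "B = {}" using B(1) by simp
    then have "intertwiners f A g B = {\<lambda>_. undefined}"
      using True by (auto simp: intertwiners_def bij_betw_def)
    \<comment> \<open>The equation \<open>0 * p 0 = 0\<close> leaves \<open>p 0\<close> free, but
      the product starts at \<open>1\<close>.\<close>
    moreover have "(\<Prod>i = 1..m. i ^ p i * fact (p i)) = (1::nat)"
    proof (intro prod.neutral ballI)
      fix i assume "i \<in> {1..m}"
      then have "p i = 0" using 0[of i] by simp
      then show "i ^ p i * fact (p i) = (1::nat)" by simp
    qed
    ultimately show ?thesis by simp
  next
    case False
    then obtain x where x: "x \<in> A" by blast
    define c where "c = card (orb f x)"
    \<comment> \<open>One cycle of length \<open>c\<close> is used up on each side.\<close>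
    define q where "q = p(c := p c - 1)"
    define S where "S = {y\<in>B. card (orb g y) = c}"
    have c0: "c > 0" unfolding c_def by (rule orb_period(1)[OF A x])
    have cm: "c \<in> {1..m}"
      using c0 card_mono[OF A(1) orb_period(2)[OF A x]] less.prems(7) by (simp add: c_def)
    have diffA: "orb_count f (A - orb f x) i = i * q i" for i
      using orb_count_Diff[OF A x, of i] p(1)[of i] by (auto simp: q_def c_def diff_mult_distrib2)
    have "c * p c = orb_count f (A - orb f x) c + c"
      using orb_count_Diff[OF A x, of c] p(1)[of c] by (simp add: c_def)
    then have pc: "p c > 0" using c0 by (cases "p c") auto
    have step: "card {h \<in> intertwiners f A g B. h x = y} = (\<Prod>i = 1..m. i ^ q i * fact (q i))"
      if y: "y \<in> S" for y
    proof -
      have yB: "y \<in> B" and yc: "card (orb g y) = c" using y by (auto simp: S_def)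
      have diffB: "orb_count g (B - orb g y) i = i * q i" for i
        using orb_count_Diff[OF B yB, of i] p(2)[of i] yc by (auto simp: q_def diff_mult_distrib2)
      have lt: "card (A - orb f x) < card A"
        using A(1) x self_in_orb[of x f] by (intro psubset_card_mono) auto
      show ?thesis
        unfolding card_intertwiners_based[OF A x B yB yc[unfolded c_def]]
        by (rule less.hyps[OF lt _ bij_betw_Diff_orb[OF A x] _ bij_betw_Diff_orb[OF B yB] diffA diffB])
           (use A(1) B(1) lt less.prems(7) in auto)
    qed
    \<comment> \<open>Sorting by the image of \<open>x\<close>, which lies on a cycle of the same
      length \<open>c\<close>.\<close>
    have "intertwiners f A g B = (\<Union>y\<in>S. {h \<in> intertwiners f A g B. h x = y})"
      using intertwiner_card_orb(2)[OF _ A(2) x] x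
      by (auto simp: S_def c_def) (auto simp: intertwiners_def dest: bij_betwE)
    then have "card (intertwiners f A g B) = card (\<Union>y\<in>S. {h \<in> intertwiners f A g B. h x = y})"
      by simp
    also have "\<dots> = (\<Sum>y\<in>S. card {h \<in> intertwiners f A g B. h x = y})"
      by (rule card_UN_disjoint) (use finite_intertwiners[OF A(1) B(1)] B(1) in \<open>auto simp: S_def\<close>)
    also have "\<dots> = card S * (\<Prod>i = 1..m. i ^ q i * fact (q i))"
      using step by simp
    also have "card S = c * p c"
      using p(2)[of c] by (simp add: S_def orb_count_def)
    also have "c * p c * (\<Prod>i = 1..m. i ^ q i * fact (q i)) =
        c * p c * (c ^ q c * fact (q c)) * (\<Prod>i\<in>{1..m} - {c}. i ^ p i * fact (p i))"
    proof -
      have "(\<Prod>i\<in>{1..m} - {c}. i ^ q i * fact (q i)) = (\<Prod>i\<in>{1..m} - {c}. i ^ p i * fact (p i) :: nat)"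
        by (intro prod.cong) (auto simp: q_def)
      then show ?thesis using cm by (subst prod.remove[of _ c]) simp_all
    qed
    also have "c * p c * (c ^ q c * fact (q c)) = c ^ p c * fact (p c)"
      using pc by (cases "p c") (simp_all add: q_def algebra_simps)
    also have "\<dots> * (\<Prod>i\<in>{1..m} - {c}. i ^ p i * fact (p i)) = (\<Prod>i = 1..m. i ^ p i * fact (p i))"
      using cm by (subst (2) prod.remove[of _ c]) simp_all
    finally show ?thesis .
  qed
qed

section \<open>Cycle types\<close>

text \<open>This keeps \<open>{1..n}\<close> from turning into an interval that starts at
  \<open>Suc 0\<close>.\<close>

declare One_nat_def [simp del]

text \<open>The division is exact by \<open>dvd_orb_count\<close>. At \<open>i = 0\<close> it yields
  \<open>0\<close>, as membership in \<open>partitions\<close> demands.\<close>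

definition cycle_type :: "nat \<Rightarrow> (nat \<Rightarrow> nat) \<Rightarrow> nat \<Rightarrow> nat" where
  "cycle_type n \<gamma> i = orb_count \<gamma> {1..n} i div i"

lemma orb_count_eq_cycle_type:
  assumes "\<gamma> permutes {1..n}"
  shows "orb_count \<gamma> {1..n} i = i * cycle_type n \<gamma> i"
  using dvd_orb_count[OF _ permutes_imp_bij[OF assms]] by (simp add: cycle_type_def)

lemma cycle_type_in_partitions:
  assumes "\<gamma> permutes {1..n}"
  shows "cycle_type n \<gamma> \<in> partitions n"
proof -
  have "cycle_type n \<gamma> i = 0" if "i \<notin> {1..n}" for i
    using orb_count_eq_0[OF _ permutes_imp_bij[OF assms], of i] that by (simp add: cycle_type_def)
  moreover have "(\<Sum>i = 1..n. i * cycle_type n \<gamma> i) = n"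
    using sum_orb_count[OF _ permutes_imp_bij[OF assms], of n]
    by (simp add: orb_count_eq_cycle_type[OF assms])
  ultimately show ?thesis by (simp add: partitions_def)
qed

text \<open>The model consists of triples \<open>(i, j, k)\<close>: position \<open>k\<close> on the
  \<open>j\<close>-th cycle of length \<open>i\<close>. The map \<open>f\<close> advances the
  position, and any bijection \<open>h\<close> with \<open>{1..n}\<close> transports it to a
  permutation.\<close>

lemma ex_permutation_of_cycle_type:
  assumes p: "p \<in> partitions n"
  shows "\<exists>\<gamma>. \<gamma> permutes {1..n} \<and> cycle_type n \<gamma> = p"
proof -
  define A :: "(nat \<times> nat \<times> nat) set" where "A = Sigma {1..n} (\<lambda>i. {..<p i} \<times> {..<i})"
  define f :: "nat \<times> nat \<times> nat \<Rightarrow> nat \<times> nat \<times> nat" where "f = (\<lambda>(i, j, k). (i, j, Suc k mod i))"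
  have fin: "finite A" by (simp add: A_def)
  have "card A = n"
    using p by (simp add: A_def partitions_def mult.commute)
  then obtain h where h: "bij_betw h A {1..n}"
    using finite_same_card_bij[OF fin, of "{1..n}"] by auto
  have pow: "(f ^^ m) (i, j, k) = (i, j, (k + m) mod i)" if "k < i" for m i j k
    using that by (induction m) (simp_all add: f_def mod_Suc_eq)
  have orbf: "card (orb f (i, j, k)) = i" if "k < i" for i j k
  proof -
    have "orb f (i, j, k) = (\<lambda>l. (i, j, l)) ` {..<i}"
    proof (intro equalityI subsetI)
      fix x assume "x \<in> (\<lambda>l. (i, j, l)) ` {..<i}"
      then obtain l where l: "l < i" "x = (i, j, l)" by auto
      have "(k + (i - k + l)) mod i = l" using l that by simp
      then have "x = (f ^^ (i - k + l)) (i, j, k)" using l pow[OF that] by simp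
      then show "x \<in> orb f (i, j, k)" unfolding orb_def by (rule range_eqI)
    qed (use that in \<open>auto simp: orb_def pow\<close>)
    moreover have "inj_on (\<lambda>l. (i, j, l)) {..<i}" by (simp add: inj_on_def)
    ultimately show ?thesis by (simp add: card_image)
  qed
  have bij: "bij_betw f A A"
  proof -
    have "f ` A = A"
    proof (intro equalityI subsetI)
      fix x assume x: "x \<in> A"
      then obtain i j k where ijk: "x = (i, j, k)" "i \<in> {1..n}" "j < p i" "k < i"
        by (auto simp: A_def)
      \<comment> \<open>The preimage is one position back; adding \<open>i - 1\<close> modulo
        \<open>i\<close> avoids subtracting from \<open>k = 0\<close>.\<close>
      have "f (i, j, (k + (i - 1)) mod i) = (i, j, Suc (k + (i - 1)) mod i)"
        by (simp add: f_def mod_Suc_eq)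
      also have "Suc (k + (i - 1)) = k + i" using ijk by simp
      also have "(k + i) mod i = k" using ijk by simp
      finally have "x = f (i, j, (k + (i - 1)) mod i)" using ijk by simp
      moreover have "(i, j, (k + (i - 1)) mod i) \<in> A" using ijk by (simp add: A_def)
      ultimately show "x \<in> f ` A" by (rule image_eqI)
    qed (auto simp: A_def f_def)
    then show ?thesis using finite_surj_inj[OF fin] by (simp add: bij_betw_def)
  qed
  define \<gamma> where "\<gamma> x = (if x \<in> {1..n} then h (f (inv_into A h x)) else x)" for x
  have \<gamma>h: "h (f x) = \<gamma> (h x)" if "x \<in> A" for x
    using that bij_betw_inv_into_left[OF h that] bij_betwE[OF h] by (auto simp: \<gamma>_def)
  have "bij_betw (h \<circ> f \<circ> inv_into A h) {1..n} {1..n}"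
    by (intro bij_betw_trans[OF bij_betw_inv_into[OF h]] bij_betw_trans[OF bij h])
  then have "bij_betw \<gamma> {1..n} {1..n}"
    by (rule bij_betw_cong[THEN iffD1, rotated]) (simp add: \<gamma>_def)
  then have perm: "\<gamma> permutes {1..n}"
    by (rule bij_imp_permutes) (auto simp: \<gamma>_def)
  have "cycle_type n \<gamma> i = p i" for i
  proof -
    have "orb_count f A i = card {x \<in> A. fst x = i}"
      unfolding orb_count_def by (rule arg_cong[of _ _ card]) (auto simp: A_def orbf)
    also have "{x \<in> A. fst x = i} = (if i \<in> {1..n} then {i} \<times> {..<p i} \<times> {..<i} else {})"
      by (auto simp: A_def)
    also have "card \<dots> = i * p i"
      using p by (auto simp: partitions_def)
    finally have "orb_count \<gamma> {1..n} i = i * p i"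
      using orb_count_conj[OF h bij \<gamma>h] by simp
    moreover have "p 0 = 0" using p by (simp add: partitions_def)
    ultimately show ?thesis by (cases "i = 0") (simp_all add: cycle_type_def)
  qed
  with perm show ?thesis by blast
qed

text \<open>Restriction to \<open>{1..n}\<close> and extension by the identity identify the
  conjugators with intertwiners. A conjugator preserves orbit counts, so there is none between
  different cycle types.\<close>

lemma card_conjugators:
  assumes \<gamma>: "\<gamma> permutes {1..n}" and \<gamma>': "\<gamma>' permutes {1..n}"
  shows "card {s. s permutes {1..n} \<and> s \<circ> \<gamma> = \<gamma>' \<circ> s} =
    (if cycle_type n \<gamma> = cycle_type n \<gamma>' then Sym n (cycle_type n \<gamma>) else 0)"
proof (cases "cycle_type n \<gamma> = cycle_type n \<gamma>'")
  case True
  let ?A = "{1..n}"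
  have "bij_betw (\<lambda>s. restrict s ?A) {s. s permutes ?A \<and> s \<circ> \<gamma> = \<gamma>' \<circ> s}
     (intertwiners \<gamma> ?A \<gamma>' ?A)"
  proof (rule bij_betw_byWitness[where f' = "\<lambda>h x. if x \<in> ?A then h x else x"])
    show "\<forall>s\<in>{s. s permutes ?A \<and> s \<circ> \<gamma> = \<gamma>' \<circ> s}. (\<lambda>x. if x \<in> ?A then restrict s ?A x else x) = s"
      by (auto simp: fun_eq_iff permutes_def)
    show "\<forall>h\<in>intertwiners \<gamma> ?A \<gamma>' ?A. restrict (\<lambda>x. if x \<in> ?A then h x else x) ?A = h"
      by (auto simp: fun_eq_iff intertwiners_def extensional_def)
    show "(\<lambda>s. restrict s ?A) ` {s. s permutes ?A \<and> s \<circ> \<gamma> = \<gamma>' \<circ> s} \<subseteq> intertwiners \<gamma> ?A \<gamma>' ?A"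
    proof (rule image_subsetI)
      fix s assume "s \<in> {s. s permutes ?A \<and> s \<circ> \<gamma> = \<gamma>' \<circ> s}"
      then have s: "s permutes ?A" and eq: "\<And>x. s (\<gamma> x) = \<gamma>' (s x)"
        by (auto simp: fun_eq_iff)
      have "bij_betw (restrict s ?A) ?A ?A"
        using permutes_imp_bij[OF s] by simp
      moreover have "\<gamma> x \<in> ?A" if "x \<in> ?A" for x
        using permutes_in_image[OF \<gamma>] that by blast
      ultimately show "restrict s ?A \<in> intertwiners \<gamma> ?A \<gamma>' ?A"
        unfolding intertwiners_def using eq by auto
    qed
    show "(\<lambda>h x. if x \<in> ?A then h x else x) ` intertwiners \<gamma> ?A \<gamma>' ?A
        \<subseteq> {s. s permutes ?A \<and> s \<circ> \<gamma> = \<gamma>' \<circ> s}"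
    proof (rule image_subsetI)
      fix h assume h: "h \<in> intertwiners \<gamma> ?A \<gamma>' ?A"
      let ?s = "\<lambda>x. if x \<in> ?A then h x else x"
      have "bij_betw ?s ?A ?A"
        by (rule bij_betw_cong[THEN iffD1, of _ h]) (use h in \<open>auto simp: intertwiners_def\<close>)
      then have "?s permutes ?A" by (rule bij_imp_permutes) auto
      moreover have "?s (\<gamma> x) = \<gamma>' (?s x)" for x
      proof (cases "x \<in> ?A")
        case True
        then show ?thesis using h permutes_in_image[OF \<gamma>, of x] by (simp add: intertwiners_def)
      next
        case False
        then show ?thesis by (simp only: permutes_not_in[OF \<gamma> False] permutes_not_in[OF \<gamma>' False] if_False)
      qed
      ultimately show "?s \<in> {s. s permutes ?A \<and> s \<circ> \<gamma> = \<gamma>' \<circ> s}" by (simp add: comp_def)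
    qed
  qed
  then have "card {s. s permutes ?A \<and> s \<circ> \<gamma> = \<gamma>' \<circ> s} = card (intertwiners \<gamma> ?A \<gamma>' ?A)"
    by (rule bij_betw_same_card)
  also have "\<dots> = Sym n (cycle_type n \<gamma>)"
    unfolding Sym_def
    by (rule card_intertwiners)
       (use True orb_count_eq_cycle_type[OF \<gamma>] orb_count_eq_cycle_type[OF \<gamma>'] in
         \<open>simp_all add: permutes_imp_bij[OF \<gamma>] permutes_imp_bij[OF \<gamma>']\<close>)
  finally show ?thesis using True by simp
next
  case False
  have "cycle_type n \<gamma> = cycle_type n \<gamma>'" if s: "s permutes {1..n}" "s \<circ> \<gamma> = \<gamma>' \<circ> s" for s
  proof -
    have "orb_count \<gamma>' {1..n} i = orb_count \<gamma> {1..n} i" for i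
      by (rule orb_count_conj[OF permutes_imp_bij[OF s(1)] permutes_imp_bij[OF \<gamma>]])
         (use s(2) in \<open>simp add: fun_eq_iff\<close>)
    then show ?thesis by (simp add: cycle_type_def fun_eq_iff)
  qed
  then have "{s. s permutes {1..n} \<and> s \<circ> \<gamma> = \<gamma>' \<circ> s} = {}" using False by blast
  then show ?thesis using False by (simp only: card.empty if_False)
qed

text \<open>Orbit-stabiliser for conjugation: all of \<open>S_n\<close> is sorted by the conjugate
  of a fixed \<gamma> under \<open>s\<close>, and every member of the class is reached by
  \<open>Sym n p\<close> permutations.\<close>

lemma card_cycle_type_class:
  assumes p: "p \<in> partitions n"
  shows "card {\<gamma>. \<gamma> permutes {1..n} \<and> cycle_type n \<gamma> = p} * Sym n p = fact n"
proof -
  obtain \<gamma> where \<gamma>: "\<gamma> permutes {1..n}" "cycle_type n \<gamma> = p"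
    using ex_permutation_of_cycle_type[OF p] by blast
  let ?G = "{s. s permutes {1..n}}"
  let ?C = "{\<gamma>. \<gamma> permutes {1..n} \<and> cycle_type n \<gamma> = p}"
  have fin: "finite ?G" by (simp add: finite_permutations)
  then have finC: "finite ?C" by (rule rev_finite_subset) auto
  have eq: "?G = (\<Union>\<gamma>'\<in>?C. {s. s permutes {1..n} \<and> s \<circ> \<gamma> = \<gamma>' \<circ> s})"
  proof (intro equalityI subsetI)
    fix s assume "s \<in> ?G"
    then have s: "s permutes {1..n}" by simp
    define \<gamma>' where "\<gamma>' = s \<circ> \<gamma> \<circ> inv_into UNIV s"
    have \<gamma>': "\<gamma>' permutes {1..n}"
      unfolding \<gamma>'_def by (intro permutes_compose permutes_inv s \<gamma>)
    have "s \<circ> \<gamma> = \<gamma>' \<circ> s"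
      unfolding \<gamma>'_def using permutes_inverses(2)[OF s] by (simp add: fun_eq_iff)
    then have s': "s \<in> {s. s permutes {1..n} \<and> s \<circ> \<gamma> = \<gamma>' \<circ> s}" using s by simp
    have "orb_count \<gamma>' {1..n} i = orb_count \<gamma> {1..n} i" for i
      by (rule orb_count_conj[OF permutes_imp_bij[OF s] permutes_imp_bij[OF \<gamma>(1)]])
         (use \<open>s \<circ> \<gamma> = \<gamma>' \<circ> s\<close> in \<open>simp add: fun_eq_iff\<close>)
    then have "cycle_type n \<gamma>' = p" unfolding \<gamma>(2)[symmetric] by (simp add: cycle_type_def fun_eq_iff)
    with \<gamma>' s' show "s \<in> (\<Union>\<gamma>'\<in>?C. {s. s permutes {1..n} \<and> s \<circ> \<gamma> = \<gamma>' \<circ> s})" by blast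
  qed auto
  have "fact n = card ?G" by (simp add: card_permutations)
  also note eq
  also have "card (\<Union>\<gamma>'\<in>?C. {s. s permutes {1..n} \<and> s \<circ> \<gamma> = \<gamma>' \<circ> s})
      = (\<Sum>\<gamma>'\<in>?C. card {s. s permutes {1..n} \<and> s \<circ> \<gamma> = \<gamma>' \<circ> s})"
  proof (rule card_UN_disjoint[OF finC])
    show "\<forall>\<gamma>'\<in>?C. finite {s. s permutes {1..n} \<and> s \<circ> \<gamma> = \<gamma>' \<circ> s}"
      by (intro ballI finite_subset[OF _ fin]) auto
    have "\<gamma>1 = \<gamma>2" if "s permutes {1..n}" "s \<circ> \<gamma> = \<gamma>1 \<circ> s" "s \<circ> \<gamma> = \<gamma>2 \<circ> s" for s \<gamma>1 \<gamma>2
    proof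
      fix x
      have "\<gamma>1 (s (inv_into UNIV s x)) = \<gamma>2 (s (inv_into UNIV s x))" using that(2,3) by (metis comp_apply)
      then show "\<gamma>1 x = \<gamma>2 x" by (simp add: permutes_inverses(1)[OF that(1)])
    qed
    then show "\<forall>\<gamma>1\<in>?C. \<forall>\<gamma>2\<in>?C. \<gamma>1 \<noteq> \<gamma>2 \<longrightarrow>
        {s. s permutes {1..n} \<and> s \<circ> \<gamma> = \<gamma>1 \<circ> s} \<inter> {s. s permutes {1..n} \<and> s \<circ> \<gamma> = \<gamma>2 \<circ> s} = {}"
      by blast
  qed
  also have "\<dots> = (\<Sum>\<gamma>'\<in>?C. Sym n p)"
    by (rule sum.cong) (use \<gamma> card_conjugators[OF \<gamma>(1)] in auto)
  finally show ?thesis by simp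
qed

section \<open>Counting double cosets\<close>

abbreviation Sn :: "nat \<Rightarrow> (nat \<Rightarrow> nat) set" where
  "Sn n \<equiv> {\<gamma>. \<gamma> permutes {1..n}}"

text \<open>Orbit-stabiliser in summed form: the stabiliser of \<sigma> is as large as the set
  \<open>?T \<sigma>\<close> of pairs carrying a fixed \<tau> to \<sigma>, and these sets partition
  all pairs.\<close>

lemma sum_stabilizers_double_coset:
  assumes C: "C \<in> perm_tuples d n // diag_rel d n"
  shows "(\<Sum>\<sigma>\<in>C. card {(g, h). (g, h) \<in> Sn n \<times> Sn n \<and> (\<forall>a\<in>{1..d}. g \<circ> \<sigma> a \<circ> h = \<sigma> a)}) = fact n * fact n"
proof -
  obtain \<tau> where \<tau>: "\<tau> \<in> perm_tuples d n" and C_eq: "C = diag_rel d n `` {\<tau>}"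
    using C by (auto elim: quotientE)
  have finC: "finite C"
    by (rule finite_subset[OF _ finite_perm_tuples[of d n]]) (auto simp: C_eq diag_rel_def)
  let ?T = "\<lambda>\<sigma>. {(g, h). (g, h) \<in> Sn n \<times> Sn n \<and> (\<forall>a\<in>{1..d}. g \<circ> \<tau> a \<circ> h = \<sigma> a)}"
  have finG: "finite (Sn n \<times> Sn n)" by (simp add: finite_permutations)
  have "card {(g, h). (g, h) \<in> Sn n \<times> Sn n \<and> (\<forall>a\<in>{1..d}. g \<circ> \<sigma> a \<circ> h = \<sigma> a)} = card (?T \<sigma>)"
    if \<sigma>: "\<sigma> \<in> C" for \<sigma>
  proof -
    obtain u v where u: "u permutes {1..n}" and v: "v permutes {1..n}"
      and uv: "\<And>a. a \<in> {1..d} \<Longrightarrow> \<sigma> a = u \<circ> \<tau> a \<circ> v"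
      using \<sigma> by (auto simp: C_eq diag_rel_def)
    let ?u = "inv_into UNIV u" and ?v = "inv_into UNIV v"
    \<comment> \<open>Translating by a pair \<open>(u, v)\<close> that carries \<tau> to \<sigma>
      turns stabilising pairs into transporting pairs.\<close>
    have "bij_betw (\<lambda>(g, h). (g \<circ> u, v \<circ> h))
      {(g, h). (g, h) \<in> Sn n \<times> Sn n \<and> (\<forall>a\<in>{1..d}. g \<circ> \<sigma> a \<circ> h = \<sigma> a)} (?T \<sigma>)"
    proof (rule bij_betw_byWitness[where f' = "\<lambda>(g, h). (g \<circ> ?u, ?v \<circ> h)"])
      show "(\<lambda>(g, h). (g \<circ> u, v \<circ> h)) `
          {(g, h). (g, h) \<in> Sn n \<times> Sn n \<and> (\<forall>a\<in>{1..d}. g \<circ> \<sigma> a \<circ> h = \<sigma> a)} \<subseteq> ?T \<sigma>"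
        using u v uv by (auto simp: permutes_compose comp_assoc)
      show "(\<lambda>(g, h). (g \<circ> ?u, ?v \<circ> h)) ` ?T \<sigma> \<subseteq>
          {(g, h). (g, h) \<in> Sn n \<times> Sn n \<and> (\<forall>a\<in>{1..d}. g \<circ> \<sigma> a \<circ> h = \<sigma> a)}"
        using permutes_inv[OF u] permutes_inv[OF v]
        by (auto simp: permutes_compose uv fun_eq_iff permutes_inverses[OF u] permutes_inverses[OF v])
    qed (auto simp: fun_eq_iff permutes_inverses[OF u] permutes_inverses[OF v])
    then show ?thesis by (rule bij_betw_same_card)
  qed
  then have "(\<Sum>\<sigma>\<in>C. card {(g, h). (g, h) \<in> Sn n \<times> Sn n \<and> (\<forall>a\<in>{1..d}. g \<circ> \<sigma> a \<circ> h = \<sigma> a)}) =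
      (\<Sum>\<sigma>\<in>C. card (?T \<sigma>))"
    by (rule sum.cong[OF refl])
  also have "\<dots> = card (\<Union>\<sigma>\<in>C. ?T \<sigma>)"
  proof (rule card_UN_disjoint[symmetric, OF finC])
    show "\<forall>\<sigma>\<in>C. finite (?T \<sigma>)"
      by (intro ballI rev_finite_subset[OF finG]) auto
    have "\<sigma> = \<rho>" if "\<sigma> \<in> C" "\<rho> \<in> C" "x \<in> ?T \<sigma>" "x \<in> ?T \<rho>" for \<sigma> \<rho> x
    proof -
      have "\<sigma> \<in> perm_tuples d n" "\<rho> \<in> perm_tuples d n" using that by (auto simp: C_eq diag_rel_def)
      moreover have "\<sigma> a = \<rho> a" if "a \<in> {1..d}" for a
        using \<open>x \<in> ?T \<sigma>\<close> \<open>x \<in> ?T \<rho>\<close> that by fastforce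
      ultimately show ?thesis unfolding perm_tuples_def by (meson PiE_ext)
    qed
    then show "\<forall>\<sigma>\<in>C. \<forall>\<rho>\<in>C. \<sigma> \<noteq> \<rho> \<longrightarrow> ?T \<sigma> \<inter> ?T \<rho> = {}" by blast
  qed
  also have "(\<Union>\<sigma>\<in>C. ?T \<sigma>) = Sn n \<times> Sn n"
  proof (intro equalityI subsetI)
    fix x assume "x \<in> Sn n \<times> Sn n"
    then obtain g h where x: "x = (g, h)" and g: "g permutes {1..n}" and h: "h permutes {1..n}" by auto
    define \<sigma> where "\<sigma> = (\<lambda>a\<in>{1..d}. g \<circ> \<tau> a \<circ> h)"
    have "g \<circ> \<tau> a \<circ> h permutes {1..n}" if "a \<in> {1..d}" for a
      using \<tau> that by (intro permutes_compose g h) (auto simp: perm_tuples_def)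
    then have "\<sigma> \<in> perm_tuples d n" unfolding perm_tuples_def \<sigma>_def by auto
    then have "\<sigma> \<in> C" unfolding C_eq diag_rel_def using \<tau> g h by (auto simp: \<sigma>_def)
    moreover have "x \<in> ?T \<sigma>" using g h by (simp add: x \<sigma>_def)
    ultimately show "x \<in> (\<Union>\<sigma>\<in>C. ?T \<sigma>)" by blast
  qed auto
  also have "card (Sn n \<times> Sn n) = fact n * fact n"
    by (simp add: card_cartesian_product card_permutations)
  finally show ?thesis .
qed

text \<open>Being fixed is a condition on each component alone; this is how \<open>d\<close> becomes
  an exponent.\<close>

lemma card_fixed_tuples:
  "card {\<sigma> \<in> perm_tuples d n. \<forall>a\<in>{1..d}. g \<circ> \<sigma> a \<circ> h = \<sigma> a} =
   card {s \<in> Sn n. g \<circ> s \<circ> h = s} ^ d"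
proof -
  have "{\<sigma> \<in> perm_tuples d n. \<forall>a\<in>{1..d}. g \<circ> \<sigma> a \<circ> h = \<sigma> a} =
      {1..d} \<rightarrow>\<^sub>E {s \<in> Sn n. g \<circ> s \<circ> h = s}"
    by (auto simp: perm_tuples_def PiE_def Pi_def)
  then show ?thesis by (simp add: card_PiE)
qed

text \<open>Double counting of a tuple together with a pair fixing it: by classes each contributes
  \<open>fact n * fact n\<close>, by pairs one gets the numbers of fixed tuples.\<close>

lemma Z_count_Burnside:
  "Z_count d n * (fact n * fact n) =
   (\<Sum>g\<in>Sn n. \<Sum>h\<in>Sn n. card {s. s permutes {1..n} \<and> s \<circ> h = g \<circ> s} ^ d)"
proof -
  have finS: "finite (Sn n)" by (simp add: finite_permutations)
  let ?fix = "\<lambda>\<sigma> g h. \<forall>a\<in>{1..d}. g \<circ> \<sigma> a \<circ> h = \<sigma> a"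
  let ?P = "perm_tuples d n"
  have "Z_count d n * (fact n * fact n) =
      (\<Sum>C\<in>?P // diag_rel d n. \<Sum>\<sigma>\<in>C. card {(g, h). (g, h) \<in> Sn n \<times> Sn n \<and> ?fix \<sigma> g h})"
    by (simp add: Z_count_def sum_stabilizers_double_coset del: mem_Sigma_iff)
  also have "\<dots> = (\<Sum>\<sigma>\<in>\<Union>(?P // diag_rel d n). card {(g, h). (g, h) \<in> Sn n \<times> Sn n \<and> ?fix \<sigma> g h})"
  proof (rule sum.Union_disjoint[symmetric, unfolded comp_def])
    have "C \<subseteq> ?P" if "C \<in> ?P // diag_rel d n" for C
      using that Union_quotient[OF equiv_diag_rel[of d n]] by blast
    then show "\<forall>C\<in>?P // diag_rel d n. finite C"
      using finite_subset[OF _ finite_perm_tuples[of d n]] by blast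
    show "\<forall>A\<in>?P // diag_rel d n. \<forall>B\<in>?P // diag_rel d n. A \<noteq> B \<longrightarrow> A \<inter> B = {}"
      using quotient_disj[OF equiv_diag_rel[of d n]] by blast
  qed
  also have "\<Union>(?P // diag_rel d n) = ?P" by (rule Union_quotient[OF equiv_diag_rel])
  also have "(\<Sum>\<sigma>\<in>?P. card {(g, h). (g, h) \<in> Sn n \<times> Sn n \<and> ?fix \<sigma> g h}) =
      (\<Sum>\<sigma>\<in>?P. \<Sum>(g, h)\<in>Sn n \<times> Sn n. if ?fix \<sigma> g h then 1 else 0)"
  proof (rule sum.cong[OF refl])
    fix \<sigma> :: "nat \<Rightarrow> nat \<Rightarrow> nat"
    have "(\<Sum>(g, h)\<in>Sn n \<times> Sn n. if ?fix \<sigma> g h then 1 else (0::nat)) =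
       (\<Sum>x\<in>Sn n \<times> Sn n. if ?fix \<sigma> (fst x) (snd x) then 1 else 0)"
      by (simp add: case_prod_beta)
    also have "\<dots> = card {x \<in> Sn n \<times> Sn n. ?fix \<sigma> (fst x) (snd x)}"
      using finS by (simp add: sum.inter_filter[symmetric] del: mem_Sigma_iff)
    also have "{x \<in> Sn n \<times> Sn n. ?fix \<sigma> (fst x) (snd x)} = {(g, h). (g, h) \<in> Sn n \<times> Sn n \<and> ?fix \<sigma> g h}"
      by auto
    finally show "card {(g, h). (g, h) \<in> Sn n \<times> Sn n \<and> ?fix \<sigma> g h} =
      (\<Sum>(g, h)\<in>Sn n \<times> Sn n. if ?fix \<sigma> g h then 1 else 0)" ..
  qed
  also have "\<dots> = (\<Sum>g\<in>Sn n. \<Sum>h\<in>Sn n. \<Sum>\<sigma>\<in>?P. if ?fix \<sigma> g h then 1 else 0)"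
    by (subst sum.swap) (rule trans[OF _ sum.cartesian_product[symmetric]], simp add: case_prod_beta)
  also have "\<dots> = (\<Sum>g\<in>Sn n. \<Sum>h\<in>Sn n. card {s \<in> Sn n. g \<circ> s \<circ> h = s} ^ d)"
    unfolding card_fixed_tuples[symmetric] by (simp add: sum.inter_filter[symmetric] finite_perm_tuples)
  \<comment> \<open>Summing over the inverse of \<open>g\<close> instead turns the fixed-point
    equation into the intertwining equation \<open>s \<circ> h = g \<circ> s\<close>.\<close>
  also have "\<dots> = (\<Sum>g\<in>Sn n. \<Sum>h\<in>Sn n. card {s \<in> Sn n. inv_into UNIV g \<circ> s \<circ> h = s} ^ d)"
    by (rule sum_permutations_inverse)
  also have "\<dots> = (\<Sum>g\<in>Sn n. \<Sum>h\<in>Sn n. card {s. s permutes {1..n} \<and> s \<circ> h = g \<circ> s} ^ d)"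
  proof (intro sum.cong refl arg_cong[of _ _ "\<lambda>x. card x ^ d"])
    fix g assume "g \<in> Sn n"
    then have inv: "inv_into UNIV g y = x \<longleftrightarrow> y = g x" for x y
      using permutes_inv_eq[of g "{1..n}" y x] by auto
    have "(inv_into UNIV g \<circ> s \<circ> h = s) = (s \<circ> h = g \<circ> s)" for s h
      by (simp add: fun_eq_iff inv)
    then show "{s \<in> Sn n. inv_into UNIV g \<circ> s \<circ> h = s} = {s. s permutes {1..n} \<and> s \<circ> h = g \<circ> s}" for h
      by auto
  qed
  finally show ?thesis .
qed

text \<open>With \<open>?c p\<close> the size of a conjugacy class, Burnside's sum is that of
  \<open>?c p\<close> squared times \<open>Sym n p ^ d\<close>. Since
  \<open>?c p * Sym n p = fact n\<close>, two of the \<open>d\<close> powers cancel against the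
  order of the acting group.\<close>

theorem Z_count_eq_sum_partitions:
  assumes "d \<ge> 2"
  shows "Z_count d n = (\<Sum>p\<in>partitions n. Sym n p ^ (d - 2))"
proof -
  have finS: "finite (Sn n)" by (simp add: finite_permutations)
  let ?c = "\<lambda>p. card {\<gamma>. \<gamma> permutes {1..n} \<and> cycle_type n \<gamma> = p}"
  \<comment> \<open>Pairs of different cycle types contribute \<open>0 ^ d\<close>, which is
    \<open>0\<close> because \<open>d\<close> is positive.\<close>
  have "Z_count d n * (fact n * fact n) =
      (\<Sum>g\<in>Sn n. \<Sum>h\<in>Sn n. if cycle_type n h = cycle_type n g then Sym n (cycle_type n g) ^ d else 0)"
    unfolding Z_count_Burnside
    by (intro sum.cong refl) (use assms in \<open>auto simp: card_conjugators\<close>)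
  also have "\<dots> = (\<Sum>g\<in>Sn n. ?c (cycle_type n g) * Sym n (cycle_type n g) ^ d)"
    by (intro sum.cong refl) (simp add: finS sum.inter_filter[symmetric] conj_commute)
  also have "\<dots> = (\<Sum>p\<in>partitions n. \<Sum>g\<in>{g \<in> Sn n. cycle_type n g = p}. ?c (cycle_type n g) * Sym n (cycle_type n g) ^ d)"
    by (rule sum.group[symmetric]) (use finS finite_partitions cycle_type_in_partitions in auto)
  also have "\<dots> = (\<Sum>p\<in>partitions n. ?c p * (?c p * Sym n p ^ d))"
    by (intro sum.cong refl) simp
  also have "\<dots> = (\<Sum>p\<in>partitions n. Sym n p ^ (d - 2) * (fact n * fact n))"
  proof (intro sum.cong refl)
    fix p assume p: "p \<in> partitions n"
    have "d = (d - 2) + 2" using assms by linarith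
    then have "Sym n p ^ d = Sym n p ^ (d - 2) * (Sym n p * Sym n p)"
      by (metis power_add power2_eq_square)
    then have "?c p * (?c p * Sym n p ^ d) = Sym n p ^ (d - 2) * ((?c p * Sym n p) * (?c p * Sym n p))"
      by (simp only: mult_ac)
    then show "?c p * (?c p * Sym n p ^ d) = Sym n p ^ (d - 2) * (fact n * fact n)"
      by (simp only: card_cycle_type_class[OF p])
  qed
  finally show ?thesis by (simp add: sum_distrib_right[symmetric])
qed

section \<open>Operators commuting with tensor powers\<close>

abbreviation idx :: "nat \<Rightarrow> nat \<Rightarrow> nat \<Rightarrow> (nat \<Rightarrow> nat \<Rightarrow> nat) set" where
  "idx d n N \<equiv> tpower_index n (U_index d N)"

text \<open>Restricting in both arguments puts the index into the extensional function spaces, where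
  values on \<open>{1..n}\<close> and \<open>{1..d}\<close> decide equality.\<close>

abbreviation tensor_index :: "nat \<Rightarrow> nat \<Rightarrow> (nat \<Rightarrow> nat \<Rightarrow> nat) \<Rightarrow> nat \<Rightarrow> nat \<Rightarrow> nat" where
  "tensor_index d n h \<equiv> \<lambda>k\<in>{1..n}. \<lambda>a\<in>{1..d}. h k a"

lemma finite_idx: "finite (idx d n N)"
  unfolding tpower_index_def U_index_def by (intro finite_PiE) auto

lemma idx_eqI:
  assumes "i \<in> idx d n N" "j \<in> idx d n N"
    and "\<And>k a. k \<in> {1..n} \<Longrightarrow> a \<in> {1..d} \<Longrightarrow> i k a = j k a"
  shows "i = j"
proof (rule PiE_ext[of _ "{1..n}" "\<lambda>_. U_index d N"])
  fix k assume k: "k \<in> {1..n}"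
  then have "i k \<in> U_index d N" "j k \<in> U_index d N"
    using assms(1,2) by (auto simp: tpower_index_def)
  then show "i k = j k"
    unfolding U_index_def by (rule PiE_ext) (rule assms(3)[OF k])
qed (use assms in \<open>auto simp: tpower_index_def\<close>)

lemma idx_bound: "i \<in> idx d n N \<Longrightarrow> k \<in> {1..n} \<Longrightarrow> a \<in> {1..d} \<Longrightarrow> i k a < N"
  by (auto simp: tpower_index_def U_index_def PiE_def Pi_def)

lemma tensor_index_in_idx:
  "(\<And>k a. k \<in> {1..n} \<Longrightarrow> a \<in> {1..d} \<Longrightarrow> h k a < N) \<Longrightarrow> tensor_index d n h \<in> idx d n N"
  by (auto simp: tpower_index_def U_index_def)

text \<open>One matrix for each factor \<open>a\<close>, repeated in all \<open>n\<close> copies;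
  \<open>W_op\<close> is the case \<open>A = fund_op g\<close>. Plain functions as matrices allow
  singular ones too.\<close>

definition kron :: "nat \<Rightarrow> nat \<Rightarrow> (nat \<Rightarrow> nat \<Rightarrow> nat \<Rightarrow> complex) \<Rightarrow>
    (nat \<Rightarrow> nat \<Rightarrow> nat) \<Rightarrow> (nat \<Rightarrow> nat \<Rightarrow> nat) \<Rightarrow> complex" where
  "kron d n A = tensor_op {1..n} (\<lambda>_. tensor_op {1..d} A)"

lemma kron_eq: "kron d n A i j = (\<Prod>k\<in>{1..n}. \<Prod>a\<in>{1..d}. A a (i k a) (j k a))"
  by (simp add: kron_def tensor_op_def)

lemma kron_cong:
  assumes "i \<in> idx d n N" "j \<in> idx d n N"
    and "\<And>a x y. a \<in> {1..d} \<Longrightarrow> x < N \<Longrightarrow> y < N \<Longrightarrow> A a x y = B a x y"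
  shows "kron d n A i j = kron d n B i j"
  unfolding kron_eq using assms idx_bound by (intro prod.cong) auto

text \<open>A product of sums is expanded twice: over the factors within one copy, then over the
  copies.\<close>

lemma kron_mult:
  "(\<Sum>j\<in>idx d n N. kron d n A i j * kron d n B j l) =
   kron d n (\<lambda>a x y. \<Sum>m<N. A a x m * B a m y) i l"
proof -
  have inner: "(\<Prod>a\<in>{1..d}. \<Sum>m<N. A a (i k a) m * B a m (l k a)) =
      (\<Sum>u\<in>U_index d N. \<Prod>a\<in>{1..d}. A a (i k a) (u a) * B a (u a) (l k a))" for k
    unfolding U_index_def by (rule prod_sum_PiE) auto
  have "kron d n (\<lambda>a x y. \<Sum>m<N. A a x m * B a m y) i l =
      (\<Prod>k\<in>{1..n}. \<Sum>u\<in>U_index d N. \<Prod>a\<in>{1..d}. A a (i k a) (u a) * B a (u a) (l k a))"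
    by (simp only: kron_eq inner)
  also have "\<dots> = (\<Sum>j\<in>idx d n N. \<Prod>k\<in>{1..n}. \<Prod>a\<in>{1..d}. A a (i k a) (j k a) * B a (j k a) (l k a))"
    unfolding tpower_index_def by (rule prod_sum_PiE) (auto simp: U_index_def intro!: finite_PiE)
  finally show ?thesis by (simp add: kron_eq prod.distrib)
qed

lemma prod_indicator:
  "finite A \<Longrightarrow> (\<Prod>x\<in>A. if P x then 1 else (0::'b::comm_semiring_1)) = (if \<forall>x\<in>A. P x then 1 else 0)"
  by (induction A rule: finite_induct) auto

lemma kron_indicator:
  "kron d n (\<lambda>a x y. if P a x y then 1 else 0) i j =
   (if \<forall>k\<in>{1..n}. \<forall>a\<in>{1..d}. P a (i k a) (j k a) then 1 else 0)"
  unfolding kron_eq by (simp add: prod_indicator)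

lemma kron_delta:
  assumes "i \<in> idx d n N" "j \<in> idx d n N"
  shows "kron d n (\<lambda>a x y. if x = y then 1 else 0) i j = (if i = j then 1 else 0)"
  unfolding kron_indicator using idx_eqI[OF assms] by auto

lemma kron_diagonal:
  assumes "i \<in> idx d n N" "j \<in> idx d n N"
  shows "kron d n (\<lambda>a x y. if x = y then D a x else 0) i j =
    (if i = j then \<Prod>k\<in>{1..n}. \<Prod>a\<in>{1..d}. D a (i k a) else 0)"
proof (cases "i = j")
  case False
  then obtain k a where "k \<in> {1..n}" "a \<in> {1..d}" "i k a \<noteq> j k a"
    using idx_eqI[OF assms] by blast
  then have "(\<Prod>k\<in>{1..n}. \<Prod>a\<in>{1..d}. if i k a = j k a then D a (i k a) else 0) = 0"
    by (intro prod_zero bexI[of _ k] bexI[of _ a]) auto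
  then show ?thesis using False by (simp add: kron_eq)
qed (simp add: kron_eq)

section \<open>Commutation with Kronecker powers\<close>

text \<open>\<open>T\<close> is read as a matrix: its index in \<open>W\<close> is the row and its
  index in the conjugate is the column.\<close>

definition commutes_kron :: "nat \<Rightarrow> nat \<Rightarrow> nat \<Rightarrow>
    ((nat \<Rightarrow> nat \<Rightarrow> nat) \<times> (nat \<Rightarrow> nat \<Rightarrow> nat) \<Rightarrow> complex) \<Rightarrow> (nat \<Rightarrow> nat \<Rightarrow> nat \<Rightarrow> complex) \<Rightarrow> bool" where
  "commutes_kron d n N T A \<longleftrightarrow> (\<forall>i\<in>idx d n N. \<forall>l\<in>idx d n N.
     (\<Sum>j\<in>idx d n N. T (i, j) * kron d n A j l) = (\<Sum>j\<in>idx d n N. kron d n A i j * T (j, l)))"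

lemma commutes_kron_cong:
  assumes "\<And>a x y. a \<in> {1..d} \<Longrightarrow> x < N \<Longrightarrow> y < N \<Longrightarrow> A a x y = B a x y"
  shows "commutes_kron d n N T A \<longleftrightarrow> commutes_kron d n N T B"
proof -
  have "kron d n A i j = kron d n B i j" if "i \<in> idx d n N" "j \<in> idx d n N" for i j
    using kron_cong[OF that assms] .
  then show ?thesis unfolding commutes_kron_def by (simp cong: sum.cong)
qed

text \<open>This closure under products is what later leads from unitary matrices to singular
  ones.\<close>

lemma commutes_kron_mult:
  assumes A: "commutes_kron d n N T A" and B: "commutes_kron d n N T B"
  shows "commutes_kron d n N T (\<lambda>a x y. \<Sum>m<N. A a x m * B a m y)"
  unfolding commutes_kron_def
proof (intro ballI)
  fix i l assume i: "i \<in> idx d n N" and l: "l \<in> idx d n N"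
  let ?I = "idx d n N" and ?A = "kron d n A" and ?B = "kron d n B"
  have "(\<Sum>j\<in>?I. T (i, j) * (\<Sum>m\<in>?I. ?A j m * ?B m l)) = (\<Sum>m\<in>?I. (\<Sum>j\<in>?I. T (i, j) * ?A j m) * ?B m l)"
    unfolding sum_distrib_left sum_distrib_right by (subst sum.swap) (simp add: mult_ac)
  also have "\<dots> = (\<Sum>m\<in>?I. (\<Sum>j\<in>?I. ?A i j * T (j, m)) * ?B m l)"
    using A i by (simp add: commutes_kron_def)
  also have "\<dots> = (\<Sum>j\<in>?I. ?A i j * (\<Sum>m\<in>?I. T (j, m) * ?B m l))"
    unfolding sum_distrib_left sum_distrib_right by (subst sum.swap) (simp add: mult_ac)
  also have "\<dots> = (\<Sum>j\<in>?I. ?A i j * (\<Sum>m\<in>?I. ?B j m * T (m, l)))"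
    using B l by (simp add: commutes_kron_def)
  also have "\<dots> = (\<Sum>m\<in>?I. (\<Sum>j\<in>?I. ?A i j * ?B j m) * T (m, l))"
    unfolding sum_distrib_left sum_distrib_right by (subst sum.swap) (simp add: mult_ac)
  finally show "(\<Sum>j\<in>?I. T (i, j) * kron d n (\<lambda>a x y. \<Sum>m<N. A a x m * B a m y) j l) =
      (\<Sum>j\<in>?I. kron d n (\<lambda>a x y. \<Sum>m<N. A a x m * B a m y) i j * T (j, l))"
    by (simp only: kron_mult)
qed

lemma commutes_kron_linear:
  assumes "\<And>\<sigma>. \<sigma> \<in> S \<Longrightarrow> commutes_kron d n N (E \<sigma>) A"
  shows "commutes_kron d n N (\<lambda>x. \<Sum>\<sigma>\<in>S. c \<sigma> * E \<sigma> x) A"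
  unfolding commutes_kron_def
proof (intro ballI)
  fix i l assume i: "i \<in> idx d n N" and l: "l \<in> idx d n N"
  let ?I = "idx d n N" and ?A = "kron d n A"
  have "(\<Sum>j\<in>?I. (\<Sum>\<sigma>\<in>S. c \<sigma> * E \<sigma> (i, j)) * ?A j l) = (\<Sum>\<sigma>\<in>S. c \<sigma> * (\<Sum>j\<in>?I. E \<sigma> (i, j) * ?A j l))"
    unfolding sum_distrib_left sum_distrib_right by (subst sum.swap) (simp add: mult_ac)
  also have "\<dots> = (\<Sum>\<sigma>\<in>S. c \<sigma> * (\<Sum>j\<in>?I. ?A i j * E \<sigma> (j, l)))"
    using assms i l by (simp add: commutes_kron_def)
  also have "\<dots> = (\<Sum>j\<in>?I. ?A i j * (\<Sum>\<sigma>\<in>S. c \<sigma> * E \<sigma> (j, l)))"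
    unfolding sum_distrib_left sum_distrib_right by (subst sum.swap) (simp add: mult_ac)
  finally show "(\<Sum>j\<in>?I. (\<Sum>\<sigma>\<in>S. c \<sigma> * E \<sigma> (i, j)) * ?A j l) =
     (\<Sum>j\<in>?I. ?A i j * (\<Sum>\<sigma>\<in>S. c \<sigma> * E \<sigma> (j, l)))" .
qed

lemma commutes_kron_diff:
  assumes "commutes_kron d n N S A" "commutes_kron d n N T A"
  shows "commutes_kron d n N (\<lambda>x. S x - T x) A"
  using assms by (simp add: commutes_kron_def algebra_simps sum_subtractf)

section \<open>Unitary matrices as coefficient functions\<close>

text \<open>Only orthonormality of the rows is demanded; that of the columns follows for square
  matrices and is supplied in \<open>unitary_fun_realised\<close>.\<close>

definition unitary_fun :: "nat \<Rightarrow> (nat \<Rightarrow> nat \<Rightarrow> complex) \<Rightarrow> bool" where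
  "unitary_fun N A \<longleftrightarrow> (\<forall>x<N. \<forall>y<N. (\<Sum>m<N. A x m * cnj (A y m)) = (if x = y then 1 else 0))"

lemma unitary_fun_delta: "unitary_fun N (\<lambda>x y. if x = y then 1 else 0)"
  unfolding unitary_fun_def by (auto simp: if_distrib[of cnj] if_distrib[of "(*) _"] cong: if_cong)

lemma index_mat_adjoint:
  "A \<in> carrier_mat N N \<Longrightarrow> x < N \<Longrightarrow> y < N \<Longrightarrow> mat_adjoint A $$ (x, y) = cnj (A $$ (y, x))"
  by (simp add: mat_adjoint_def mat_of_rows_def)

lemma mat_adjoint_carrier: "A \<in> carrier_mat N N \<Longrightarrow> mat_adjoint A \<in> carrier_mat N N"
  by (auto simp: mat_adjoint_def mat_of_rows_def)

lemma index_mult_mat_sum: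
  "A \<in> carrier_mat N N \<Longrightarrow> B \<in> carrier_mat N N \<Longrightarrow> x < N \<Longrightarrow> y < N \<Longrightarrow>
   (A * B) $$ (x, y) = (\<Sum>m<N. A $$ (x, m) * B $$ (m, y))"
  by (simp add: scalar_prod_def atLeast0LessThan)

lemma unitary_group_index:
  assumes "A \<in> unitary_group N" "x < N" "y < N"
  shows "(\<Sum>m<N. A $$ (x, m) * cnj (A $$ (y, m))) = (if x = y then 1 else 0)"
    and "(\<Sum>m<N. cnj (A $$ (m, x)) * A $$ (m, y)) = (if x = y then 1 else 0)"
proof -
  have A: "A \<in> carrier_mat N N" "A * mat_adjoint A = 1\<^sub>m N" "mat_adjoint A * A = 1\<^sub>m N"
    using assms(1) by (auto simp: unitary_group_def)
  have "(A * mat_adjoint A) $$ (x, y) = (if x = y then 1 else 0)" 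
    "(mat_adjoint A * A) $$ (x, y) = (if x = y then 1 else 0)"
    unfolding A(2,3) using assms by auto
  then show "(\<Sum>m<N. A $$ (x, m) * cnj (A $$ (y, m))) = (if x = y then 1 else 0)"
    and "(\<Sum>m<N. cnj (A $$ (m, x)) * A $$ (m, y)) = (if x = y then 1 else 0)"
    using assms by (simp_all add: index_mult_mat_sum[OF A(1) mat_adjoint_carrier[OF A(1)]]
      index_mult_mat_sum[OF mat_adjoint_carrier[OF A(1)] A(1)] index_mat_adjoint[OF A(1)] del: index_mult_mat)
qed

lemma unitary_fun_fund_op:
  assumes "g \<in> unitary_tuples d N" "a \<in> {1..d}"
  shows "unitary_fun N (fund_op g a)"
proof -
  have "g a \<in> unitary_group N" using assms by (auto simp: unitary_tuples_def)
  then show ?thesis by (simp add: unitary_fun_def fund_op_def unitary_group_index(1))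
qed

lemma unitary_fun_realised:
  assumes "\<And>a. a \<in> {1..d} \<Longrightarrow> unitary_fun N (A a)"
  shows "\<exists>g\<in>unitary_tuples d N. \<forall>a\<in>{1..d}. \<forall>x<N. \<forall>y<N. fund_op g a x y = A a x y"
proof -
  define g where "g = (\<lambda>a\<in>{1..d}. mat N N (\<lambda>(x, y). A a x y))"
  have "g a \<in> unitary_group N" if a: "a \<in> {1..d}" for a
  proof -
    have c: "g a \<in> carrier_mat N N" using a by (simp add: g_def)
    have "(g a * mat_adjoint (g a)) $$ (x, y) = 1\<^sub>m N $$ (x, y)" if "x < N" "y < N" for x y
      using that assms[OF a] a
      by (simp add: index_mult_mat_sum[OF c mat_adjoint_carrier[OF c]] index_mat_adjoint[OF c] del: index_mult_mat)
         (simp add: g_def unitary_fun_def)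
    then have "g a * mat_adjoint (g a) = 1\<^sub>m N"
      using c mat_adjoint_carrier[OF c] by (intro eq_matI) auto
    then show ?thesis
      using c mat_mult_left_right_inverse[OF c mat_adjoint_carrier[OF c]] by (simp add: unitary_group_def)
  qed
  then have "g \<in> unitary_tuples d N" by (auto simp: unitary_tuples_def g_def)
  moreover have "\<forall>a\<in>{1..d}. \<forall>x<N. \<forall>y<N. fund_op g a x y = A a x y"
    by (simp add: fund_op_def g_def)
  ultimately show ?thesis by blast
qed

lemma kron_conj: "kron d n (conj_op g) i j = cnj (kron d n (fund_op g) i j)"
  by (simp add: kron_eq conj_op_def fund_op_def)

lemma kron_unitary:
  assumes g: "g \<in> unitary_tuples d N" and i: "i \<in> idx d n N" and l: "l \<in> idx d n N"
  shows "(\<Sum>j\<in>idx d n N. kron d n (fund_op g) i j * cnj (kron d n (fund_op g) l j)) = (if i = l then 1 else 0)"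
    and "(\<Sum>j\<in>idx d n N. cnj (kron d n (fund_op g) j i) * kron d n (fund_op g) j l) = (if i = l then 1 else 0)"
proof -
  have g': "g a \<in> unitary_group N" if "a \<in> {1..d}" for a
    using g that by (auto simp: unitary_tuples_def)
  have "(\<Sum>j\<in>idx d n N. kron d n (fund_op g) i j * cnj (kron d n (fund_op g) l j)) =
      (\<Sum>j\<in>idx d n N. kron d n (fund_op g) i j * kron d n (\<lambda>a x y. cnj (g a $$ (y, x))) j l)"
    by (simp add: kron_eq fund_op_def)
  also have "\<dots> = kron d n (\<lambda>a x y. if x = y then 1 else 0) i l"
    unfolding kron_mult by (rule kron_cong[OF i l]) (use unitary_group_index(1)[OF g'] in \<open>simp add: fund_op_def\<close>)
  finally show "(\<Sum>j\<in>idx d n N. kron d n (fund_op g) i j * cnj (kron d n (fund_op g) l j)) = (if i = l then 1 else 0)"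
    by (simp add: kron_delta[OF i l])
  have "(\<Sum>j\<in>idx d n N. cnj (kron d n (fund_op g) j i) * kron d n (fund_op g) j l) =
      (\<Sum>j\<in>idx d n N. kron d n (\<lambda>a x y. cnj (g a $$ (y, x))) i j * kron d n (fund_op g) j l)"
    by (simp add: kron_eq fund_op_def)
  also have "\<dots> = kron d n (\<lambda>a x y. if x = y then 1 else 0) i l"
    unfolding kron_mult by (rule kron_cong[OF i l]) (use unitary_group_index(2)[OF g'] in \<open>simp add: fund_op_def\<close>)
  finally show "(\<Sum>j\<in>idx d n N. cnj (kron d n (fund_op g) j i) * kron d n (fund_op g) j l) = (if i = l then 1 else 0)"
    by (simp add: kron_delta[OF i l])
qed

section \<open>Invariance as commutation\<close>

lemma op_apply_WWbar:
  assumes "i \<in> idx d n N" "j \<in> idx d n N"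
  shows "op_apply (idx d n N \<times> idx d n N) (tensor_op2 (W_op d n g) (Wbar_op d n g)) T (i, j) =
    (\<Sum>j'\<in>idx d n N. cnj (kron d n (fund_op g) j j') * (\<Sum>i'\<in>idx d n N. kron d n (fund_op g) i i' * T (i', j')))"
proof -
  have W: "W_op d n g = kron d n (fund_op g)" "Wbar_op d n g = kron d n (conj_op g)"
    by (simp_all add: W_op_def Wbar_op_def kron_def)
  have "op_apply (idx d n N \<times> idx d n N) (tensor_op2 (W_op d n g) (Wbar_op d n g)) T (i, j) =
     (\<Sum>i'\<in>idx d n N. \<Sum>j'\<in>idx d n N. kron d n (fund_op g) i i' * cnj (kron d n (fund_op g) j j') * T (i', j'))"
    using assms by (simp add: op_apply_def tensor_op2_def W kron_conj sum.cartesian_product case_prod_beta)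
  also have "\<dots> = (\<Sum>j'\<in>idx d n N. cnj (kron d n (fund_op g) j j') * (\<Sum>i'\<in>idx d n N. kron d n (fund_op g) i i' * T (i', j')))"
    unfolding sum_distrib_left by (subst sum.swap) (simp add: mult_ac)
  finally show ?thesis .
qed

text \<open>With \<open>G\<close> the Kronecker power of \<open>g\<close>, the action sends the
  matrix \<open>T\<close> to \<open>G\<close> times \<open>T\<close> times the adjoint of
  \<open>G\<close>. Both directions cancel \<open>G\<close> against its adjoint.\<close>

lemma invariant_iff_commutes:
  assumes g: "g \<in> unitary_tuples d N" and T: "T \<in> coord_space (idx d n N \<times> idx d n N)"
  shows "op_apply (idx d n N \<times> idx d n N) (tensor_op2 (W_op d n g) (Wbar_op d n g)) T = T \<longleftrightarrow>
    commutes_kron d n N T (fund_op g)" (is "?L \<longleftrightarrow> ?R")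
proof
  let ?I = "idx d n N" and ?G = "kron d n (fund_op g)"
  assume ?L
  then have inv: "T (i, j) = (\<Sum>j'\<in>?I. cnj (?G j j') * (\<Sum>i'\<in>?I. ?G i i' * T (i', j')))"
    if "i \<in> ?I" "j \<in> ?I" for i j
    using op_apply_WWbar[OF that, of g T] by simp
  show ?R unfolding commutes_kron_def
  proof (intro ballI)
    fix i l assume i: "i \<in> ?I" and l: "l \<in> ?I"
    have "(\<Sum>j\<in>?I. T (i, j) * ?G j l) =
        (\<Sum>j\<in>?I. (\<Sum>j'\<in>?I. cnj (?G j j') * (\<Sum>i'\<in>?I. ?G i i' * T (i', j'))) * ?G j l)"
      using inv[OF i] by simp
    also have "\<dots> = (\<Sum>j'\<in>?I. (\<Sum>j\<in>?I. cnj (?G j j') * ?G j l) * (\<Sum>i'\<in>?I. ?G i i' * T (i', j')))"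
      unfolding sum_distrib_right by (subst sum.swap) (simp add: mult_ac)
    also have "\<dots> = (\<Sum>j'\<in>?I. if j' = l then \<Sum>i'\<in>?I. ?G i i' * T (i', j') else 0)"
      by (rule sum.cong[OF refl]) (simp add: kron_unitary(2)[OF g _ l])
    also have "\<dots> = (\<Sum>i'\<in>?I. ?G i i' * T (i', l))"
      using l by (simp add: finite_idx)
    finally show "(\<Sum>j\<in>?I. T (i, j) * ?G j l) = (\<Sum>i'\<in>?I. ?G i i' * T (i', l))" .
  qed
next
  let ?I = "idx d n N" and ?G = "kron d n (fund_op g)"
  assume R: ?R
  show ?L
  proof
    fix x
    show "op_apply (?I \<times> ?I) (tensor_op2 (W_op d n g) (Wbar_op d n g)) T x = T x"
    proof (cases "x \<in> ?I \<times> ?I")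
      case True
      then obtain i j where x: "x = (i, j)" and i: "i \<in> ?I" and j: "j \<in> ?I" by blast
      have "op_apply (?I \<times> ?I) (tensor_op2 (W_op d n g) (Wbar_op d n g)) T (i, j) =
         (\<Sum>j'\<in>?I. cnj (?G j j') * (\<Sum>l\<in>?I. T (i, l) * ?G l j'))"
        unfolding op_apply_WWbar[OF i j] using R i by (simp add: commutes_kron_def)
      also have "\<dots> = (\<Sum>l\<in>?I. T (i, l) * (\<Sum>j'\<in>?I. ?G l j' * cnj (?G j j')))"
        unfolding sum_distrib_left by (subst sum.swap) (simp add: mult_ac)
      also have "\<dots> = (\<Sum>l\<in>?I. if l = j then T (i, l) else 0)"
        by (rule sum.cong[OF refl]) (simp add: kron_unitary(1)[OF g _ j])
      also have "\<dots> = T (i, j)" using j by (simp add: finite_idx)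
      finally show ?thesis by (simp add: x)
    next
      case False
      then show ?thesis using T by (cases x) (auto simp: op_apply_def coord_space_def)
    qed
  qed
qed

lemma invariant_iff_commutes_unitary:
  assumes T: "T \<in> coord_space (idx d n N \<times> idx d n N)"
  shows "(\<forall>g\<in>unitary_tuples d N.
      op_apply (idx d n N \<times> idx d n N) (tensor_op2 (W_op d n g) (Wbar_op d n g)) T = T) \<longleftrightarrow>
    (\<forall>A. (\<forall>a\<in>{1..d}. unitary_fun N (A a)) \<longrightarrow> commutes_kron d n N T A)"
proof -
  have "commutes_kron d n N T A"
    if *: "\<forall>g\<in>unitary_tuples d N. commutes_kron d n N T (fund_op g)" and A: "\<forall>a\<in>{1..d}. unitary_fun N (A a)" for A
  proof -
    obtain g where g: "g \<in> unitary_tuples d N" "\<forall>a\<in>{1..d}. \<forall>x<N. \<forall>y<N. fund_op g a x y = A a x y"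
      using unitary_fun_realised[of d N A] A by blast
    then have "commutes_kron d n N T (fund_op g) = commutes_kron d n N T A"
      by (intro commutes_kron_cong) auto
    with * g show ?thesis by blast
  qed
  then show ?thesis using invariant_iff_commutes[OF _ T] unitary_fun_fund_op by blast
qed

section \<open>From unitary to singular matrices\<close>

definition commutes_unitary :: "nat \<Rightarrow> nat \<Rightarrow> nat \<Rightarrow>
    ((nat \<Rightarrow> nat \<Rightarrow> nat) \<times> (nat \<Rightarrow> nat \<Rightarrow> nat) \<Rightarrow> complex) \<Rightarrow> bool" where
  "commutes_unitary d n N T \<longleftrightarrow> (\<forall>A. (\<forall>a\<in>{1..d}. unitary_fun N (A a)) \<longrightarrow> commutes_kron d n N T A)"

lemma commutes_unitaryD:
  "commutes_unitary d n N T \<Longrightarrow> (\<And>a. a \<in> {1..d} \<Longrightarrow> unitary_fun N (A a)) \<Longrightarrow> commutes_kron d n N T A"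
  by (simp add: commutes_unitary_def)

text \<open>Diagonal matrices scale basis vectors, so commutation becomes a condition on each entry
  of \<open>T\<close> separately.\<close>

lemma commutes_kron_diagonal_iff:
  "commutes_kron d n N T (\<lambda>a x y. if x = y then D a x else 0) \<longleftrightarrow>
   (\<forall>i\<in>idx d n N. \<forall>l\<in>idx d n N. T (i, l) * (\<Prod>k\<in>{1..n}. \<Prod>a\<in>{1..d}. D a (l k a)) =
      (\<Prod>k\<in>{1..n}. \<Prod>a\<in>{1..d}. D a (i k a)) * T (i, l))"
proof -
  let ?I = "idx d n N" and ?K = "kron d n (\<lambda>a x y. if x = y then D a x else 0)"
  let ?p = "\<lambda>i. \<Prod>k\<in>{1..n}. \<Prod>a\<in>{1..d}. D a (i k a)"
  have "(\<Sum>j\<in>?I. T (i, j) * ?K j l) = T (i, l) * ?p l" "(\<Sum>j\<in>?I. ?K i j * T (j, l)) = ?p i * T (i, l)"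
    if "i \<in> ?I" "l \<in> ?I" for i l
  proof -
    have "(\<Sum>j\<in>?I. T (i, j) * ?K j l) = (\<Sum>j\<in>?I. if j = l then T (i, l) * ?p l else 0)"
      by (rule sum.cong) (use that in \<open>auto simp: kron_diagonal\<close>)
    then show "(\<Sum>j\<in>?I. T (i, j) * ?K j l) = T (i, l) * ?p l" using that by (simp add: finite_idx)
    have "(\<Sum>j\<in>?I. ?K i j * T (j, l)) = (\<Sum>j\<in>?I. if i = j then ?p i * T (i, l) else 0)"
      by (rule sum.cong) (use that in \<open>auto simp: kron_diagonal\<close>)
    then show "(\<Sum>j\<in>?I. ?K i j * T (j, l)) = ?p i * T (i, l)" using that by (simp add: finite_idx)
  qed
  then show ?thesis unfolding commutes_kron_def by simp
qed

lemma unitary_fun_diagonal: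
  assumes "\<And>x. norm (z x) = 1"
  shows "unitary_fun N (\<lambda>x y. if x = y then z x else 0)"
proof -
  have "z x * cnj (z x) = 1" for x
    using assms[of x] by (simp add: complex_norm_square[symmetric])
  moreover have "(\<Sum>m<N. (if x = m then z x else 0) * cnj (if y = m then z y else 0)) =
     (\<Sum>m<N. if m = x then (if x = y then z x * cnj (z x) else 0) else 0)" for x y
    by (intro sum.cong) auto
  ultimately show ?thesis by (simp add: unitary_fun_def)
qed

text \<open>The torus acts on the matrix unit at \<open>(i, j)\<close> by a character, which is trivial only if \<open>i\<close> and
  \<open>j\<close> contain the same entries with the same multiplicities.\<close>

lemma commutes_unitary_same_content:
  assumes T: "commutes_unitary d n N T" and i: "i \<in> idx d n N" and j: "j \<in> idx d n N"
    and nz: "T (i, j) \<noteq> 0" and a: "a \<in> {1..d}"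
  shows "card {k\<in>{1..n}. i k a = m} = card {k\<in>{1..n}. j k a = m}"
proof -
  \<comment> \<open>The counts lie between \<open>0\<close> and \<open>n\<close>, so their multiples
    of the angle \<open>1 / (n + 1)\<close> stay in \<open>[0, pi]\<close>, where the cosine is
    injective. Hence powers of \<open>z\<close> determine the counts.\<close>
  define z where "z = cis (1 / real (n + 1))"
  \<comment> \<open>The torus element touches only the entry \<open>m\<close> in the factor
    \<open>a\<close>; it scales a basis vector by \<open>z\<close> to the number of occurrences of
    \<open>m\<close> there.\<close>
  define D where "D = (\<lambda>b x. if b = a \<and> x = m then z else 1)"
  let ?c = "\<lambda>l. card {k\<in>{1..n}. l k a = m}"
  have "commutes_kron d n N T (\<lambda>a x y. if x = y then D a x else 0)"
    using T by (rule commutes_unitaryD) (rule unitary_fun_diagonal, simp add: D_def z_def)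
  then have eq: "(\<Prod>k\<in>{1..n}. \<Prod>b\<in>{1..d}. D b (j k b)) = (\<Prod>k\<in>{1..n}. \<Prod>b\<in>{1..d}. D b (i k b))"
  proof -
    assume "commutes_kron d n N T (\<lambda>a x y. if x = y then D a x else 0)"
    then have "T (i, j) * (\<Prod>k\<in>{1..n}. \<Prod>b\<in>{1..d}. D b (j k b)) =
        (\<Prod>k\<in>{1..n}. \<Prod>b\<in>{1..d}. D b (i k b)) * T (i, j)"
      unfolding commutes_kron_diagonal_iff using i j by blast
    then show ?thesis using nz by (simp add: mult.commute[of "T (i, j)"])
  qed
  have "(\<Prod>k\<in>{1..n}. \<Prod>b\<in>{1..d}. D b (l k b)) = z ^ ?c l" for l :: "nat \<Rightarrow> nat \<Rightarrow> nat"
  proof -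
    have "(\<Prod>b\<in>{1..d}. D b (l k b)) = (if l k a = m then z else 1)" for k
    proof -
      have "(\<Prod>b\<in>{1..d}. D b (l k b)) = (\<Prod>b\<in>{1..d}. if b = a then (if l k a = m then z else 1) else 1)"
        by (rule prod.cong) (auto simp: D_def)
      then show ?thesis using a by simp
    qed
    then show ?thesis by (simp add: prod.inter_filter[symmetric])
  qed
  with eq have "z ^ ?c i = z ^ ?c j" by simp
  then have "Re (z ^ ?c i) = Re (z ^ ?c j)" by (rule arg_cong)
  then have cos_eq: "cos (real (?c i) * (1 / real (n + 1))) = cos (real (?c j) * (1 / real (n + 1)))"
    by (simp only: z_def Complex.DeMoivre cis.sel)
  have rng: "0 \<le> real (?c l) * (1 / real (n + 1))" "real (?c l) * (1 / real (n + 1)) \<le> pi"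
    for l :: "nat \<Rightarrow> nat \<Rightarrow> nat"
  proof -
    have "?c l \<le> card {1..n}" by (rule card_mono) auto
    then have "real (?c l) * (1 / real (n + 1)) \<le> 1" by simp
    also have "\<dots> \<le> pi" using pi_gt3 by simp
    finally show "real (?c l) * (1 / real (n + 1)) \<le> pi" .
  qed simp
  have "real (?c i) * (1 / real (n + 1)) = real (?c j) * (1 / real (n + 1))"
    by (rule cos_inj_pi[OF rng(1)[of i] rng(2)[of i] rng(1)[of j] rng(2)[of j] cos_eq])
  then show ?thesis by simp
qed

text \<open>The scalar by which a diagonal matrix acts on a basis vector depends only on the content
  of its index, and \<open>T\<close> links only indices of equal content. The diagonal entries may
  be \<open>0\<close>.\<close>

lemma commutes_kron_any_diagonal:
  assumes T: "commutes_unitary d n N T"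
  shows "commutes_kron d n N T (\<lambda>a x y. if x = y then D a x else 0)"
  unfolding commutes_kron_diagonal_iff
proof (intro ballI)
  fix i l assume i: "i \<in> idx d n N" and l: "l \<in> idx d n N"
  have content: "(\<Prod>k\<in>{1..n}. \<Prod>a\<in>{1..d}. D a (j k a)) =
      (\<Prod>a\<in>{1..d}. \<Prod>m<N. D a m ^ card {k\<in>{1..n}. j k a = m})" if j: "j \<in> idx d n N" for j
  proof (subst prod.swap, rule prod.cong[OF refl])
    fix a assume a: "a \<in> {1..d}"
    have "(\<Prod>k\<in>{1..n}. D a (j k a)) = (\<Prod>m<N. \<Prod>k\<in>{k\<in>{1..n}. j k a = m}. D a (j k a))"
      by (rule prod.group[symmetric]) (use idx_bound[OF j _ a] in auto)
    also have "\<dots> = (\<Prod>m<N. D a m ^ card {k\<in>{1..n}. j k a = m})"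
      by (rule prod.cong) auto
    finally show "(\<Prod>k\<in>{1..n}. D a (j k a)) = (\<Prod>m<N. D a m ^ card {k\<in>{1..n}. j k a = m})" .
  qed
  show "T (i, l) * (\<Prod>k\<in>{1..n}. \<Prod>a\<in>{1..d}. D a (l k a)) =
      (\<Prod>k\<in>{1..n}. \<Prod>a\<in>{1..d}. D a (i k a)) * T (i, l)"
  proof (cases "T (i, l) = 0")
    case False
    have "(\<Prod>a\<in>{1..d}. \<Prod>m<N. D a m ^ card {k\<in>{1..n}. l k a = m}) =
        (\<Prod>a\<in>{1..d}. \<Prod>m<N. D a m ^ card {k\<in>{1..n}. i k a = m})"
      by (intro prod.cong refl) (simp only: commutes_unitary_same_content[OF T i l False])
    then show ?thesis unfolding content[OF i] content[OF l] by simp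
  qed simp
qed

section \<open>Permutations and mergings of basis vectors\<close>

text \<open>The matrix sending the basis vector at \<open>y\<close> to the one at
  \<open>f a y\<close>; \<open>f a\<close> may fail to be injective.\<close>

definition map_op :: "(nat \<Rightarrow> nat \<Rightarrow> nat) \<Rightarrow> nat \<Rightarrow> nat \<Rightarrow> nat \<Rightarrow> complex" where
  "map_op f a x y = (if x = f a y then 1 else 0)"

text \<open>If the map carries the basis vector at \<open>l\<close> to that at \<open>l'\<close>,
  commutation makes column \<open>l'\<close> of \<open>T\<close> the image of column
  \<open>l\<close>, so it vanishes as well.\<close>

lemma commutes_map_op_vanish:
  assumes T: "commutes_kron d n N T (map_op f)"
    and l: "l \<in> idx d n N" and vanish: "\<And>i. i \<in> idx d n N \<Longrightarrow> T (i, l) = 0"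
    and l': "l' \<in> idx d n N" "\<And>k a. k \<in> {1..n} \<Longrightarrow> a \<in> {1..d} \<Longrightarrow> l' k a = f a (l k a)"
    and i: "i \<in> idx d n N"
  shows "T (i, l') = 0"
proof -
  have K: "kron d n (map_op f) j l = (if j = l' then 1 else 0)" if "j \<in> idx d n N" for j
  proof -
    have "j = l' \<longleftrightarrow> (\<forall>k\<in>{1..n}. \<forall>a\<in>{1..d}. j k a = f a (l k a))"
      using idx_eqI[OF that l'(1)] l'(2) by metis
    then show ?thesis unfolding map_op_def kron_indicator by simp
  qed
  have "T (i, l') = (\<Sum>j\<in>idx d n N. if j = l' then T (i, j) else 0)"
    using l'(1) by (simp add: finite_idx)
  also have "\<dots> = (\<Sum>j\<in>idx d n N. T (i, j) * kron d n (map_op f) j l)"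
    by (rule sum.cong) (simp_all add: K)
  also have "\<dots> = (\<Sum>j\<in>idx d n N. kron d n (map_op f) i j * T (j, l))"
    using T i l by (simp add: commutes_kron_def)
  also have "\<dots> = 0" by (simp add: vanish)
  finally show ?thesis .
qed

lemma unitary_fun_permutation:
  assumes "bij_betw s {..<N} {..<N}"
  shows "unitary_fun N (\<lambda>x y. if x = s y then 1 else 0)"
  unfolding unitary_fun_def
proof (intro allI impI)
  fix x y assume x: "x < N" and y: "y < N"
  obtain m0 where m0: "m0 < N" "x = s m0"
    using bij_betw_imp_surj_on[OF assms] x by (metis imageE lessThan_iff)
  have inj: "s m0 = s m \<longleftrightarrow> m = m0" if "m < N" for m
    using bij_betw_imp_inj_on[OF assms] that m0(1) by (auto simp: inj_on_def)
  have "(\<Sum>m<N. (if x = s m then 1 else 0) * cnj (if y = s m then 1 else 0)) =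
     (\<Sum>m<N. if m = m0 then (if x = y then 1 else 0) else 0)"
    by (rule sum.cong) (auto simp: m0(2) inj)
  then show "(\<Sum>m<N. (if x = s m then 1 else 0) * cnj (if y = s m then 1 else 0)) = (if x = y then 1 else 0)"
    using m0(1) by simp
qed

lemma commutes_permutation:
  assumes "commutes_unitary d n N T" "\<And>a. a \<in> {1..d} \<Longrightarrow> bij_betw (f a) {..<N} {..<N}"
  shows "commutes_kron d n N T (map_op f)"
  using assms(1) by (rule commutes_unitaryD) (use unitary_fun_permutation[OF assms(2)] in \<open>simp add: map_op_def[abs_def]\<close>)

definition hadamard :: "nat \<Rightarrow> nat \<Rightarrow> nat \<Rightarrow> nat \<Rightarrow> complex" where
  "hadamard m q x y =
    (if x \<in> {m, q} \<and> y \<in> {m, q} then complex_of_real (if x = q \<and> y = q then - (1 / sqrt 2) else 1 / sqrt 2)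
     else if x = y then 1 else 0)"

lemma unitary_fun_hadamard:
  assumes "m < N" "q < N" "m \<noteq> q"
  shows "unitary_fun N (hadamard m q)"
  unfolding unitary_fun_def
proof (intro allI impI)
  fix x y assume x: "x < N" and y: "y < N"
  have half: "complex_of_real (1 / sqrt 2) * complex_of_real (1 / sqrt 2) = 1 / 2"
    unfolding of_real_mult[symmetric] by (simp flip: of_real_mult)
  show "(\<Sum>k<N. hadamard m q x k * cnj (hadamard m q y k)) = (if x = y then 1 else 0)"
  proof (cases "x \<in> {m, q}")
    case True
    have "(\<Sum>k<N. hadamard m q x k * cnj (hadamard m q y k)) =
        (\<Sum>k\<in>{m, q}. hadamard m q x k * cnj (hadamard m q y k))"
      by (rule sum.mono_neutral_right) (use assms True in \<open>auto simp: hadamard_def\<close>)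
    also have "\<dots> = (if x = y then 1 else 0)"
      using True assms(3) half by (auto simp: hadamard_def)
    finally show ?thesis .
  next
    case False
    have "(\<Sum>k<N. hadamard m q x k * cnj (hadamard m q y k)) =
        (\<Sum>k<N. if k = x then (if x = y then 1 else 0) else 0)"
      by (rule sum.cong) (use False in \<open>auto simp: hadamard_def\<close>)
    then show ?thesis using x by simp
  qed
qed

text \<open>The matrix sending \<open>e\<^sub>q\<close> and \<open>e\<^sub>m\<close> to \<open>e\<^sub>m\<close> and fixing the other basis vectors is singular, but it is
  a diagonal matrix times the unitary Hadamard matrix in the coordinates \<open>m\<close> and \<open>q\<close>.\<close>

lemma commutes_collapse:
  assumes T: "commutes_unitary d n N T" and "m < N" "q < N" "m \<noteq> q"
  shows "commutes_kron d n N T (map_op (\<lambda>b y. if b = a \<and> y = q then m else y))"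
proof -
  \<comment> \<open>The entry \<open>sqrt 2\<close> undoes the normalisation of the Hadamard row
    \<open>m\<close>, which becomes \<open>1\<close> in both columns \<open>m\<close> and
    \<open>q\<close>; the entry \<open>0\<close> deletes row \<open>q\<close>.\<close>
  define D :: "nat \<Rightarrow> nat \<Rightarrow> complex"
    where "D = (\<lambda>b x. if b = a then (if x = m then complex_of_real (sqrt 2) else if x = q then 0 else 1) else 1)"
  define H where "H = (\<lambda>b. if b = a then hadamard m q else (\<lambda>x y. if x = y then 1 else 0))"
  have "commutes_kron d n N T H"
    using T by (rule commutes_unitaryD) (simp add: H_def unitary_fun_hadamard[OF assms(2-4)] unitary_fun_delta)
  then have "commutes_kron d n N T (\<lambda>b x y. \<Sum>k<N. (if x = k then D b x else 0) * H b k y)"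
    by (rule commutes_kron_mult[OF commutes_kron_any_diagonal[OF T]])
  moreover have "(\<Sum>k<N. (if x = k then D b x else 0) * H b k y) =
      map_op (\<lambda>b y. if b = a \<and> y = q then m else y) b x y" if "x < N" "y < N" for b x y
  proof -
    have "(\<Sum>k<N. (if x = k then D b x else 0) * H b k y) = (\<Sum>k<N. if k = x then D b x * H b x y else 0)"
      by (rule sum.cong) auto
    also have "\<dots> = D b x * H b x y" using that by simp
    also have "\<dots> = map_op (\<lambda>b y. if b = a \<and> y = q then m else y) b x y"
      using assms(4) by (auto simp: D_def H_def map_op_def hadamard_def simp flip: of_real_mult)
    finally show ?thesis .
  qed
  ultimately show ?thesis by (subst commutes_kron_cong) auto
qed

section \<open>Reduction to a single column\<close>

lemma vanish_of_vanish_injective: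
  assumes T: "commutes_unitary d n N T" and nN: "n \<le> N"
    and inj: "\<And>i l. i \<in> idx d n N \<Longrightarrow> l \<in> idx d n N \<Longrightarrow>
      (\<And>a. a \<in> {1..d} \<Longrightarrow> inj_on (\<lambda>k. l k a) {1..n}) \<Longrightarrow> T (i, l) = 0"
    and "i \<in> idx d n N" "l \<in> idx d n N"
  shows "T (i, l) = 0"
  using assms(4,5)
proof (induction "\<Sum>a\<in>{1..d}. n - card ((\<lambda>k. l k a) ` {1..n})" arbitrary: i l rule: less_induct)
  case less
  note i = less.prems(1) and l = less.prems(2)
  show ?case
  proof (cases "\<forall>a\<in>{1..d}. inj_on (\<lambda>k. l k a) {1..n}")
    case True
    then show ?thesis using inj i l by blast
  next
    case False
    then obtain a k1 k2 where a: "a \<in> {1..d}" and k: "k1 \<in> {1..n}" "k2 \<in> {1..n}" "k1 \<noteq> k2" "l k1 a = l k2 a"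
      unfolding inj_on_def by blast
    let ?im = "\<lambda>l a. (\<lambda>k. l k a) ` {1..n}"
    have card_le: "card (?im l' b) \<le> n" for l' :: "nat \<Rightarrow> nat \<Rightarrow> nat" and b
      using card_image_le[of "{1..n}" "\<lambda>k. l' k b"] by simp
    have "card (?im l a) \<noteq> card {1..n}"
    proof
      assume "card (?im l a) = card {1..n}"
      then have "inj_on (\<lambda>k. l k a) {1..n}" by (intro eq_card_imp_inj_on) auto
      then show False using k by (auto dest: inj_onD)
    qed
    then have lt: "card (?im l a) < n" using card_le[of l a] by simp
    have "?im l a \<subseteq> {..<N}" using idx_bound[OF l _ a] by auto
    moreover have "?im l a \<noteq> {..<N}" using lt nN by auto
    ultimately obtain q where q: "q < N" "q \<notin> ?im l a" by blast
    define m where "m = l k1 a"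
    have m: "m < N" using idx_bound[OF l k(1) a] by (simp add: m_def)
    have mq: "m \<noteq> q" using q k by (auto simp: m_def)
    define l' where "l' = tensor_index d n (\<lambda>k b. if k = k1 \<and> b = a then q else l k b)"
    have l': "l' \<in> idx d n N"
      unfolding l'_def by (rule tensor_index_in_idx) (use idx_bound[OF l] q in auto)
    have "?im l' a = insert q (?im l a)"
    proof (intro equalityI subsetI)
      fix x assume "x \<in> insert q (?im l a)"
      \<comment> \<open>The value overwritten at \<open>k1\<close> is still taken at
        \<open>k2\<close>, so the image only gains \<open>q\<close>.\<close>
      then consider "x = q" | k where "k \<in> {1..n}" "k \<noteq> k1" "x = l k a"
        using k by (metis (no_types, lifting) image_iff insert_iff)
      then show "x \<in> ?im l' a"
      proof cases
        case 1
        then show ?thesis using k(1) a by (intro image_eqI[of _ _ k1]) (auto simp: l'_def)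
      next
        case (2 k)
        then show ?thesis using a by (intro image_eqI[of _ _ k]) (auto simp: l'_def)
      qed
    qed (use a in \<open>auto simp: l'_def\<close>)
    then have card_a: "card (?im l' a) = Suc (card (?im l a))" using q(2) by simp
    have card_b: "card (?im l' b) = card (?im l b)" if "b \<in> {1..d}" "b \<noteq> a" for b
      using that by (intro arg_cong[of _ _ card] image_cong) (auto simp: l'_def)
    have "(\<Sum>b\<in>{1..d}. n - card (?im l' b)) < (\<Sum>b\<in>{1..d}. n - card (?im l b))"
    proof (rule sum_strict_mono_ex1)
      show "\<forall>b\<in>{1..d}. n - card (?im l' b) \<le> n - card (?im l b)"
      proof
        fix b assume "b \<in> {1..d}"
        then show "n - card (?im l' b) \<le> n - card (?im l b)"
          using card_a card_b[of b] by (cases "b = a") simp_all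
      qed
      show "\<exists>b\<in>{1..d}. n - card (?im l' b) < n - card (?im l b)"
        using a card_a lt by (intro bexI[of _ a]) auto
    qed simp
    then have vanish: "T (i', l') = 0" if "i' \<in> idx d n N" for i'
      using less.hyps[OF _ that l'] by blast
    show ?thesis
    proof (rule commutes_map_op_vanish[OF commutes_collapse[OF T m q(1) mq, of a] l' vanish l _ i])
      fix k b assume "k \<in> {1..n}" "b \<in> {1..d}"
      then show "l k b = (if b = a \<and> l' k b = q then m else l' k b)"
        using q(2) by (auto simp: l'_def m_def)
    qed
  qed
qed

text \<open>The complements of domain and image have equal size, so the injection extends. The shift
  \<open>k - 1\<close> reconciles copies numbered from \<open>1\<close> with basis vectors numbered
  from \<open>0\<close>.\<close>

lemma ex_bij_betw_extension:
  fixes h :: "nat \<Rightarrow> nat"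
  assumes "inj_on h {1..n}" "h ` {1..n} \<subseteq> {..<N}"
  shows "\<exists>s. bij_betw s {..<N} {..<N} \<and> (\<forall>k\<in>{1..n}. s (k - 1) = h k)"
proof -
  have nN: "n \<le> N"
    using card_inj_on_le[OF assms] by simp
  have Suc: "Suc ` {..<n} = {1..n}" by (simp add: image_Suc_lessThan)
  have "inj_on (h \<circ> Suc) {..<n}"
    by (rule comp_inj_on) (simp_all add: Suc assms(1))
  then have b1: "bij_betw (h \<circ> Suc) {..<n} (h ` {1..n})"
    unfolding bij_betw_def image_comp[symmetric] Suc by simp
  have "card ({..<N} - {..<n}) = card ({..<N} - h ` {1..n})"
    using assms nN by (simp add: card_Diff_subset card_image)
  then obtain t where b2: "bij_betw t ({..<N} - {..<n}) ({..<N} - h ` {1..n})"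
    using finite_same_card_bij[of "{..<N} - {..<n}" "{..<N} - h ` {1..n}"] by auto
  define s where "s x = (if x < n then h (Suc x) else t x)" for x
  have "bij_betw s {..<n} (h ` {1..n})"
    using b1 by (rule bij_betw_cong[THEN iffD1, rotated]) (simp add: s_def)
  moreover have "bij_betw s ({..<N} - {..<n}) ({..<N} - h ` {1..n})"
    using b2 by (rule bij_betw_cong[THEN iffD1, rotated]) (simp add: s_def)
  ultimately have "bij_betw s ({..<n} \<union> ({..<N} - {..<n})) (h ` {1..n} \<union> ({..<N} - h ` {1..n}))"
    by (rule bij_betw_combine) auto
  moreover have "{..<n} \<union> ({..<N} - {..<n}) = {..<N}" "h ` {1..n} \<union> ({..<N} - h ` {1..n}) = {..<N}"
    using assms(2) nN by auto
  moreover have "s (k - 1) = h k" if "k \<in> {1..n}" for k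
  proof -
    have "k - 1 < n" "Suc (k - 1) = k" using that by auto
    then show ?thesis by (simp add: s_def)
  qed
  ultimately show ?thesis by (intro exI[of _ s]) simp
qed

text \<open>The reference column: every factor reads \<open>0\<close>, ..., \<open>n - 1\<close>
  along the copies.\<close>

abbreviation base_index :: "nat \<Rightarrow> nat \<Rightarrow> nat \<Rightarrow> nat \<Rightarrow> nat" where
  "base_index d n \<equiv> tensor_index d n (\<lambda>k a. k - 1)"

lemma base_index_in_idx: "n \<le> N \<Longrightarrow> base_index d n \<in> idx d n N"
  by (rule tensor_index_in_idx) auto

text \<open>An index with distinct entries in each factor arises from the base index by permuting
  basis vectors, which is unitary.\<close>

lemma vanish_of_vanish_base:
  assumes T: "commutes_unitary d n N T" and nN: "n \<le> N"
    and base: "\<And>i. i \<in> idx d n N \<Longrightarrow> T (i, base_index d n) = 0"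
    and i: "i \<in> idx d n N" and l: "l \<in> idx d n N"
  shows "T (i, l) = 0"
proof (rule vanish_of_vanish_injective[OF T nN _ i l])
  fix i l assume i: "i \<in> idx d n N" and l: "l \<in> idx d n N"
    and inj: "\<And>a. a \<in> {1..d} \<Longrightarrow> inj_on (\<lambda>k. l k a) {1..n}"
  have "\<exists>s. bij_betw s {..<N} {..<N} \<and> (\<forall>k\<in>{1..n}. s (k - 1) = l k a)" if a: "a \<in> {1..d}" for a
    by (rule ex_bij_betw_extension[OF inj[OF a]]) (use idx_bound[OF l _ a] in auto)
  then obtain f where f: "\<And>a. a \<in> {1..d} \<Longrightarrow> bij_betw (f a) {..<N} {..<N}"
    "\<And>a k. a \<in> {1..d} \<Longrightarrow> k \<in> {1..n} \<Longrightarrow> f a (k - 1) = l k a"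
    by metis
  show "T (i, l) = 0"
    by (rule commutes_map_op_vanish[OF commutes_permutation[OF T f(1)] base_index_in_idx[OF nN] base l _ i])
       (use f(2) in auto)
qed

section \<open>The commutant of the unitary groups\<close>

definition permute_index :: "nat \<Rightarrow> nat \<Rightarrow> (nat \<Rightarrow> nat \<Rightarrow> nat) \<Rightarrow> (nat \<Rightarrow> nat \<Rightarrow> nat) \<Rightarrow> nat \<Rightarrow> nat \<Rightarrow> nat" where
  "permute_index d n \<sigma> j = tensor_index d n (\<lambda>k a. j (\<sigma> a k) a)"

text \<open>The matrix of the operator that permutes the \<open>n\<close> copies of the factor
  \<open>a\<close> by \<open>\<sigma> a\<close>, independently for each \<open>a\<close>.\<close>

definition perm_tensor :: "nat \<Rightarrow> nat \<Rightarrow> nat \<Rightarrow> (nat \<Rightarrow> nat \<Rightarrow> nat) \<Rightarrow>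
    (nat \<Rightarrow> nat \<Rightarrow> nat) \<times> (nat \<Rightarrow> nat \<Rightarrow> nat) \<Rightarrow> complex" where
  "perm_tensor d n N \<sigma> x =
     (if snd x \<in> idx d n N \<and> fst x = permute_index d n \<sigma> (snd x) then 1 else 0)"

definition inv_tuple :: "nat \<Rightarrow> (nat \<Rightarrow> nat \<Rightarrow> nat) \<Rightarrow> nat \<Rightarrow> nat \<Rightarrow> nat" where
  "inv_tuple d \<sigma> = (\<lambda>a\<in>{1..d}. inv_into UNIV (\<sigma> a))"

lemma perm_tuples_permutes: "\<sigma> \<in> perm_tuples d n \<Longrightarrow> a \<in> {1..d} \<Longrightarrow> \<sigma> a permutes {1..n}"
  by (auto simp: perm_tuples_def)

lemma perm_tuples_eqI:
  assumes "\<sigma> \<in> perm_tuples d n" "\<tau> \<in> perm_tuples d n"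
    and "\<And>a k. a \<in> {1..d} \<Longrightarrow> k \<in> {1..n} \<Longrightarrow> \<sigma> a k = \<tau> a k"
  shows "\<sigma> = \<tau>"
proof (rule PiE_ext[OF assms(1,2)[unfolded perm_tuples_def]])
  fix a assume a: "a \<in> {1..d}"
  show "\<sigma> a = \<tau> a"
  proof
    fix k
    show "\<sigma> a k = \<tau> a k"
      using assms(3)[OF a] permutes_not_in[OF perm_tuples_permutes[OF assms(1) a], of k]
        permutes_not_in[OF perm_tuples_permutes[OF assms(2) a], of k] by (cases "k \<in> {1..n}") simp_all
  qed
qed

lemma perm_tuples_mem: "\<sigma> \<in> perm_tuples d n \<Longrightarrow> a \<in> {1..d} \<Longrightarrow> k \<in> {1..n} \<Longrightarrow> \<sigma> a k \<in> {1..n}"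
  using permutes_in_image[OF perm_tuples_permutes] by blast

lemma inv_tuple_in: "\<sigma> \<in> perm_tuples d n \<Longrightarrow> inv_tuple d \<sigma> \<in> perm_tuples d n"
  by (auto simp: perm_tuples_def inv_tuple_def intro!: permutes_inv)

lemma permute_index_in_idx:
  "\<sigma> \<in> perm_tuples d n \<Longrightarrow> j \<in> idx d n N \<Longrightarrow> permute_index d n \<sigma> j \<in> idx d n N"
  unfolding permute_index_def by (rule tensor_index_in_idx) (rule idx_bound, auto dest: perm_tuples_mem)

lemma permute_index_inverse:
  assumes \<sigma>: "\<sigma> \<in> perm_tuples d n" and j: "j \<in> idx d n N"
  shows "permute_index d n \<sigma> (permute_index d n (inv_tuple d \<sigma>) j) = j"
    and "permute_index d n (inv_tuple d \<sigma>) (permute_index d n \<sigma> j) = j"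
proof -
  have inv: "inv_into UNIV (\<sigma> a) (\<sigma> a k) = k" "\<sigma> a (inv_into UNIV (\<sigma> a) k) = k" if "a \<in> {1..d}" for a k
    using permutes_inverses[OF perm_tuples_permutes[OF \<sigma> that]] by auto
  note mem = perm_tuples_mem[OF \<sigma>] perm_tuples_mem[OF inv_tuple_in[OF \<sigma>]]
  note in_idx = permute_index_in_idx[OF \<sigma>] permute_index_in_idx[OF inv_tuple_in[OF \<sigma>]]
  show "permute_index d n \<sigma> (permute_index d n (inv_tuple d \<sigma>) j) = j"
    by (rule idx_eqI[OF in_idx(1)[OF in_idx(2)[OF j]] j])
       (use mem(1) inv(1) in \<open>simp add: permute_index_def inv_tuple_def\<close>)
  show "permute_index d n (inv_tuple d \<sigma>) (permute_index d n \<sigma> j) = j"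
    by (rule idx_eqI[OF in_idx(2)[OF in_idx(1)[OF j]] j])
       (use mem(2) inv(2) in \<open>simp add: permute_index_def inv_tuple_def\<close>)
qed

text \<open>All copies carry the same matrix \<open>A a\<close>, so for each \<open>a\<close> the
  product over the copies may be reindexed by \<open>\<sigma> a\<close>.\<close>

lemma kron_permute_index:
  assumes \<sigma>: "\<sigma> \<in> perm_tuples d n"
  shows "kron d n A (permute_index d n (inv_tuple d \<sigma>) i) l = kron d n A i (permute_index d n \<sigma> l)"
proof -
  have "kron d n A (permute_index d n (inv_tuple d \<sigma>) i) l =
      (\<Prod>a\<in>{1..d}. \<Prod>k\<in>{1..n}. A a (i (inv_into UNIV (\<sigma> a) k) a) (l k a))"
    unfolding kron_eq by (subst prod.swap) (simp add: permute_index_def inv_tuple_def)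
  also have "\<dots> = (\<Prod>a\<in>{1..d}. \<Prod>k\<in>{1..n}. A a (i k a) (l (\<sigma> a k) a))"
  proof (rule prod.cong[OF refl])
    fix a assume a: "a \<in> {1..d}"
    show "(\<Prod>k\<in>{1..n}. A a (i (inv_into UNIV (\<sigma> a) k) a) (l k a)) = (\<Prod>k\<in>{1..n}. A a (i k a) (l (\<sigma> a k) a))"
      by (subst prod.permute[OF perm_tuples_permutes[OF \<sigma> a]])
         (simp add: permutes_inverses(2)[OF perm_tuples_permutes[OF \<sigma> a]])
  qed
  also have "\<dots> = kron d n A i (permute_index d n \<sigma> l)"
    unfolding kron_eq by (subst prod.swap) (simp add: permute_index_def)
  finally show ?thesis .
qed

lemma commutes_perm_tensor:
  assumes \<sigma>: "\<sigma> \<in> perm_tuples d n"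
  shows "commutes_kron d n N (perm_tensor d n N \<sigma>) A"
  unfolding commutes_kron_def
proof (intro ballI)
  let ?I = "idx d n N" and ?K = "kron d n A" and ?E = "perm_tensor d n N \<sigma>"
  fix i l assume i: "i \<in> ?I" and l: "l \<in> ?I"
  have E: "?E (i, j) = (if j = permute_index d n (inv_tuple d \<sigma>) i then 1 else 0)" if "j \<in> ?I" for j
    using permute_index_inverse[OF \<sigma> that] permute_index_inverse[OF \<sigma> i] that
    by (auto simp: perm_tensor_def)
  have "(\<Sum>j\<in>?I. ?E (i, j) * ?K j l) = (\<Sum>j\<in>?I. if j = permute_index d n (inv_tuple d \<sigma>) i then ?K j l else 0)"
    by (rule sum.cong) (simp_all add: E)
  also have "\<dots> = ?K (permute_index d n (inv_tuple d \<sigma>) i) l"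
    using permute_index_in_idx[OF inv_tuple_in[OF \<sigma>] i] by (simp add: finite_idx)
  also have "\<dots> = ?K i (permute_index d n \<sigma> l)" by (rule kron_permute_index[OF \<sigma>])
  also have "\<dots> = (\<Sum>j\<in>?I. if j = permute_index d n \<sigma> l then ?K i j else 0)"
    using permute_index_in_idx[OF \<sigma> l] by (simp add: finite_idx)
  also have "\<dots> = (\<Sum>j\<in>?I. ?K i j * ?E (j, l))"
    by (rule sum.cong) (simp_all add: perm_tensor_def l)
  finally show "(\<Sum>j\<in>?I. ?E (i, j) * ?K j l) = (\<Sum>j\<in>?I. ?K i j * ?E (j, l))" .
qed

text \<open>Distinct entries in each factor of \<open>j\<close> let the tuple be recovered from the
  permuted index. Hence such a column separates the permutation tensors.\<close>

lemma perm_tensor_at_injective: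
  assumes \<sigma>: "\<sigma> \<in> perm_tuples d n" and \<tau>: "\<tau> \<in> perm_tuples d n" and j: "j \<in> idx d n N"
    and inj: "\<And>a. a \<in> {1..d} \<Longrightarrow> inj_on (\<lambda>k. j k a) {1..n}"
  shows "perm_tensor d n N \<sigma> (permute_index d n \<tau> j, j) = (if \<sigma> = \<tau> then 1 else 0)"
proof -
  have "\<sigma> = \<tau>" if eq: "permute_index d n \<tau> j = permute_index d n \<sigma> j"
  proof (rule perm_tuples_eqI[OF \<sigma> \<tau>])
    fix a k assume a: "a \<in> {1..d}" and k: "k \<in> {1..n}"
    have "j (\<tau> a k) a = j (\<sigma> a k) a"
      using fun_cong[OF fun_cong[OF eq, of k], of a] a k by (simp add: permute_index_def)
    then show "\<sigma> a k = \<tau> a k"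
      using inj_onD[OF inj[OF a]] perm_tuples_mem[OF \<sigma> a k] perm_tuples_mem[OF \<tau> a k] by metis
  qed
  then show ?thesis using j by (auto simp: perm_tensor_def)
qed

lemma inj_on_base_index: "a \<in> {1..d} \<Longrightarrow> inj_on (\<lambda>k. base_index d n k a) {1..n}"
  by (auto simp: inj_on_def)

text \<open>First fundamental theorem for a product of unitary groups, in the range \<open>n \<le> N\<close> where the
  coefficients can be read off at a single column.\<close>

lemma commutes_unitary_expansion:
  assumes T: "commutes_unitary d n N T" and coord: "T \<in> coord_space (idx d n N \<times> idx d n N)" and nN: "n \<le> N"
  shows "T x = (\<Sum>\<sigma>\<in>perm_tuples d n. T (permute_index d n \<sigma> (base_index d n), base_index d n) * perm_tensor d n N \<sigma> x)"
proof -
  let ?b = "base_index d n" and ?P = "perm_tuples d n"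
  define c where "c \<sigma> = T (permute_index d n \<sigma> ?b, ?b)" for \<sigma>
  define S where "S x = (\<Sum>\<sigma>\<in>?P. c \<sigma> * perm_tensor d n N \<sigma> x)" for x
  \<comment> \<open>The remainder also commutes with the unitary group, so it suffices to see that
    its base column vanishes.\<close>
  define R where "R x = T x - S x" for x
  note b = base_index_in_idx[OF nN, of d]
  have R: "commutes_unitary d n N R"
    unfolding commutes_unitary_def R_def S_def
    using T by (auto simp: commutes_unitary_def intro!: commutes_kron_diff commutes_kron_linear commutes_perm_tensor)
  have "R (i, ?b) = 0" if i: "i \<in> idx d n N" for i
  proof (rule ccontr)
    assume nz: "R (i, ?b) \<noteq> 0"
    \<comment> \<open>A nonzero entry in the base column forces \<open>i\<close> to contain each of
      \<open>0\<close>, ..., \<open>n - 1\<close> once in every factor. Adding \<open>1\<close>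
      turns these entries into a permutation of \<open>{1..n}\<close>.\<close>
    define \<sigma> where "\<sigma> = (\<lambda>a\<in>{1..d}. \<lambda>k. if k \<in> {1..n} then i k a + 1 else k)"
    have "(\<lambda>k. if k \<in> {1..n} then i k a + 1 else k) permutes {1..n}" if a: "a \<in> {1..d}" for a
    proof (rule bij_imp_permutes)
      have count: "card {k\<in>{1..n}. i k a = m} = card {k\<in>{1..n}. k - 1 = m}" for m
        using commutes_unitary_same_content[OF R i b nz a, of m] a by (simp cong: conj_cong)
      have "m \<in> (\<lambda>k. i k a + 1) ` {1..n}" if m: "m \<in> {1..n}" for m
      proof -
        have "{k\<in>{1..n}. k - 1 = m - 1} = {m}" using m by auto
        then have "card {k\<in>{1..n}. i k a = m - 1} = 1" unfolding count by simp
        then have "{k\<in>{1..n}. i k a = m - 1} \<noteq> {}" by (metis card.empty zero_neq_one)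
        then obtain k where "k \<in> {1..n}" "i k a = m - 1" by blast
        then show ?thesis using m by (intro image_eqI[of _ _ k]) auto
      qed
      then have sub: "{1..n} \<subseteq> (\<lambda>k. i k a + 1) ` {1..n}" by blast
      then have im: "(\<lambda>k. i k a + 1) ` {1..n} = {1..n}"
        using card_image_le[of "{1..n}" "\<lambda>k. i k a + 1"]
        by (intro card_seteq[symmetric]) auto
      moreover have "inj_on (\<lambda>k. i k a + 1) {1..n}"
        by (rule eq_card_imp_inj_on) (simp_all only: im finite_atLeastAtMost)
      ultimately have "bij_betw (\<lambda>k. i k a + 1) {1..n} {1..n}"
        unfolding bij_betw_def by (rule conjI[rotated])
      then show "bij_betw (\<lambda>k. if k \<in> {1..n} then i k a + 1 else k) {1..n} {1..n}"
        by (rule bij_betw_cong[THEN iffD1, rotated]) simp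
    qed (simp del: atLeastAtMost_iff)
    then have \<sigma>: "\<sigma> \<in> ?P" by (auto simp: \<sigma>_def perm_tuples_def)
    have i_eq: "i = permute_index d n \<sigma> ?b"
    proof (rule idx_eqI[OF i permute_index_in_idx[OF \<sigma> b]])
      fix k a assume "k \<in> {1..n}" "a \<in> {1..d}"
      then show "i k a = permute_index d n \<sigma> ?b k a"
        using perm_tuples_mem[OF \<sigma>, of a k] by (simp add: permute_index_def \<sigma>_def)
    qed
    have "S (i, ?b) = (\<Sum>\<tau>\<in>?P. if \<tau> = \<sigma> then c \<tau> else 0)"
      unfolding S_def
    proof (rule sum.cong[OF refl])
      fix \<tau> assume "\<tau> \<in> ?P"
      then have "perm_tensor d n N \<tau> (i, ?b) = (if \<tau> = \<sigma> then 1 else 0)"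
        unfolding i_eq by (rule perm_tensor_at_injective[OF _ \<sigma> b inj_on_base_index])
      then show "c \<tau> * perm_tensor d n N \<tau> (i, ?b) = (if \<tau> = \<sigma> then c \<tau> else 0)"
        by simp
    qed
    also have "\<dots> = T (i, ?b)" using \<sigma> by (simp add: finite_perm_tuples c_def flip: i_eq)
    finally show False using nz by (simp add: R_def)
  qed
  then have zero: "R (i, l) = 0" if "i \<in> idx d n N" "l \<in> idx d n N" for i l
    using vanish_of_vanish_base[OF R nN _ that] by blast
  have "T x = S x"
  proof (cases "x \<in> idx d n N \<times> idx d n N")
    case True
    then show ?thesis using zero by (cases x) (auto simp: R_def)
  next
    case False
    then have "perm_tensor d n N \<sigma> x = 0" if "\<sigma> \<in> ?P" for \<sigma>
      using permute_index_in_idx[OF that] by (cases x) (auto simp: perm_tensor_def)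
    then have "S x = 0" by (simp add: S_def)
    moreover have "T x = 0" using coord False unfolding coord_space_def by blast
    ultimately show ?thesis by simp
  qed
  then show ?thesis by (simp add: S_def c_def)
qed

section \<open>The dimension of the space of invariants\<close>

definition bisymmetric :: "nat \<Rightarrow> nat \<Rightarrow> nat \<Rightarrow>
    ((nat \<Rightarrow> nat \<Rightarrow> nat) \<times> (nat \<Rightarrow> nat \<Rightarrow> nat) \<Rightarrow> complex) \<Rightarrow> bool" where
  "bisymmetric d n N T \<longleftrightarrow> T \<in> coord_space (idx d n N \<times> idx d n N) \<and>
     (\<forall>\<pi> \<rho> i j. \<pi> permutes {1..n} \<longrightarrow> \<rho> permutes {1..n} \<longrightarrow> T (i \<circ> \<pi>, j \<circ> \<rho>) = T (i, j))"

lemma sum_fun_apply: "(\<Sum>s\<in>S. F s) x = (\<Sum>s\<in>S. F s x :: 'b::comm_monoid_add)"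
  by (induction S rule: infinite_finite_induct) auto

text \<open>Such an \<open>f\<close> equals the symmetrisation of its expansion in unit vectors:
  each of the \<open>fact n\<close> permutations contributes \<open>f j / fact n\<close>.\<close>

lemma sum_symmetrize_unit:
  fixes f :: "(nat \<Rightarrow> 'i) \<Rightarrow> complex"
  assumes "finite (tpower_index n I)"
    and sym: "\<And>\<pi> i. \<pi> permutes {1..n} \<Longrightarrow> f (i \<circ> \<pi>) = f i"
    and zero: "\<And>i. i \<notin> tpower_index n I \<Longrightarrow> f i = 0"
  shows "(\<Sum>i\<in>tpower_index n I. f i * symmetrize n (\<lambda>i'. if i' = i then 1 else 0) j) = f j"
proof -
  let ?I = "tpower_index n I" and ?S = "{\<pi>. \<pi> permutes {1..n}}"
  have "(\<Sum>i\<in>?I. f i * symmetrize n (\<lambda>i'. if i' = i then 1 else 0) j) =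
      (\<Sum>i\<in>?I. \<Sum>\<pi>\<in>?S. if i = j \<circ> \<pi> then f i / fact n else 0)"
    unfolding symmetrize_def
    by (rule sum.cong) (auto simp: sum_distrib_left sum_divide_distrib intro!: sum.cong)
  also have "\<dots> = (\<Sum>\<pi>\<in>?S. \<Sum>i\<in>?I. if i = j \<circ> \<pi> then f i / fact n else 0)"
    by (rule sum.swap)
  also have "\<dots> = (\<Sum>\<pi>\<in>?S. f j / fact n)"
  proof (rule sum.cong[OF refl])
    fix \<pi> assume "\<pi> \<in> ?S"
    then have \<pi>: "\<pi> permutes {1..n}" by simp
    have "(\<Sum>i\<in>?I. if i = j \<circ> \<pi> then f i / fact n else 0) = (if j \<circ> \<pi> \<in> ?I then f (j \<circ> \<pi>) / fact n else 0)"
      using assms(1) by simp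
    also have "\<dots> = f j / fact n" using zero[of j] by (simp add: tpower_index_comp[OF \<pi>] sym[OF \<pi>])
    finally show "(\<Sum>i\<in>?I. if i = j \<circ> \<pi> then f i / fact n else 0) = f j / fact n" .
  qed
  also have "\<dots> = f j" by (simp add: card_permutations)
  finally show ?thesis .
qed

text \<open>Bisymmetric tensors form a subspace containing the generators. Conversely,
  \<open>sum_symmetrize_unit\<close> in each argument expands a bisymmetric tensor in products of
  symmetrised unit vectors.\<close>

lemma tensor_subspaces_W_iff:
  "T \<in> tensor_subspaces (W_space d n N) (W_space d n N) \<longleftrightarrow> bisymmetric d n N T"
proof
  let ?I = "idx d n N"
  let ?G = "{tensor_vec2 x y | x y. x \<in> W_space d n N \<and> y \<in> W_space d n N}"
  have "tensor_subspaces (W_space d n N) (W_space d n N) \<subseteq> Collect (bisymmetric d n N)"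
    unfolding tensor_subspaces_def
  proof (rule cvec.span_minimal)
    show "?G \<subseteq> Collect (bisymmetric d n N)"
      unfolding W_space_def mem_sym_power_iff
      by (auto simp: bisymmetric_def tensor_vec2_def coord_space_def)
    show "cvec.subspace (Collect (bisymmetric d n N))"
      by (rule cvec.subspaceI) (auto simp: bisymmetric_def coord_space_def cscale_def)
  qed
  then show "T \<in> tensor_subspaces (W_space d n N) (W_space d n N) \<Longrightarrow> bisymmetric d n N T" by blast
  assume T: "bisymmetric d n N T"
  define s where "s i = symmetrize n (\<lambda>i'. if i' = i then 1 else (0::complex))" for i :: "nat \<Rightarrow> nat \<Rightarrow> nat"
  have s: "s i \<in> W_space d n N" if "i \<in> ?I" for i
    unfolding W_space_def sym_power_def s_def using that by (intro imageI) (auto simp: coord_space_def)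
  have "T (i', j') = (\<Sum>i\<in>?I. \<Sum>j\<in>?I. T (i, j) * (s i i' * s j j'))" for i' j'
  proof -
    have "(\<Sum>j\<in>?I. T (i, j) * s j j') = T (i, j')" for i
      unfolding s_def
    proof (rule sum_symmetrize_unit[OF finite_idx])
      fix \<pi> j assume "\<pi> permutes {1..n}"
      then have "T (i \<circ> id, j \<circ> \<pi>) = T (i, j)" using T permutes_id unfolding bisymmetric_def by blast
      then show "T (i, j \<circ> \<pi>) = T (i, j)" by simp
    qed (use T in \<open>auto simp: bisymmetric_def coord_space_def\<close>)
    then have "(\<Sum>i\<in>?I. \<Sum>j\<in>?I. T (i, j) * (s i i' * s j j')) = (\<Sum>i\<in>?I. T (i, j') * s i i')"
      by (simp add: sum_distrib_right[symmetric] mult.assoc[symmetric] mult.commute[of "s _ i'"] mult.left_commute[of _ "s _ i'"])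
    also have "\<dots> = T (i', j')"
      unfolding s_def
    proof (rule sum_symmetrize_unit[OF finite_idx])
      fix \<pi> i assume "\<pi> permutes {1..n}"
      then have "T (i \<circ> \<pi>, j' \<circ> id) = T (i, j')" using T permutes_id unfolding bisymmetric_def by blast
      then show "T (i \<circ> \<pi>, j') = T (i, j')" by simp
    qed (use T in \<open>auto simp: bisymmetric_def coord_space_def\<close>)
    finally show ?thesis ..
  qed
  then have "T = (\<Sum>x\<in>?I \<times> ?I. cscale (T x) (tensor_vec2 (s (fst x)) (s (snd x))))"
    by (simp add: fun_eq_iff sum_fun_apply cscale_def tensor_vec2_def sum.cartesian_product case_prod_beta)
  also have "\<dots> \<in> tensor_subspaces (W_space d n N) (W_space d n N)"
    unfolding tensor_subspaces_def
  proof (intro cvec.span_sum cvec.span_scale cvec.span_base)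
    fix x assume x: "x \<in> ?I \<times> ?I"
    show "tensor_vec2 (s (fst x)) (s (snd x)) \<in> ?G"
      by (intro CollectI exI[of _ "s (fst x)"] exI[of _ "s (snd x)"] conjI refl s)
         (use x in \<open>simp_all add: mem_Times_iff\<close>)
  qed
  finally show "T \<in> tensor_subspaces (W_space d n N) (W_space d n N)" .
qed

lemma mem_WWbar_invariants_iff:
  "T \<in> WWbar_invariants d n N \<longleftrightarrow> bisymmetric d n N T \<and> commutes_unitary d n N T"
  unfolding WWbar_invariants_def commutes_unitary_def tensor_subspaces_W_iff mem_Collect_eq
  using invariant_iff_commutes_unitary[where T = T and d = d and n = n and N = N] by (auto simp: bisymmetric_def)

section \<open>Double cosets and class tensors\<close>

text \<open>Multiplying by \<open>g\<close> on the left relabels the copies of the column index, and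
  by \<open>h\<close> on the right those of the row index. This is the link between double cosets
  and the two symmetrisations.\<close>

lemma permute_index_comp:
  assumes "j \<in> idx d n N" "\<sigma> \<in> perm_tuples d n" "\<tau> \<in> perm_tuples d n"
    and g: "g permutes {1..n}" and h: "h permutes {1..n}"
    and \<tau>: "\<And>a. a \<in> {1..d} \<Longrightarrow> \<tau> a = g \<circ> \<sigma> a \<circ> h"
  shows "permute_index d n \<tau> j = permute_index d n \<sigma> (j \<circ> g) \<circ> h"
proof -
  have jg: "j \<circ> g \<in> idx d n N" using assms(1) tpower_index_comp[OF g] by blast
  have lhs: "permute_index d n \<tau> j \<in> idx d n N" by (rule permute_index_in_idx[OF assms(3,1)])
  have rhs: "permute_index d n \<sigma> (j \<circ> g) \<circ> h \<in> idx d n N"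
    using permute_index_in_idx[OF assms(2) jg] tpower_index_comp[OF h] by blast
  show ?thesis
  proof (rule idx_eqI[OF lhs rhs])
    fix k a assume ka: "k \<in> {1..n}" "a \<in> {1..d}"
    have "h k \<in> {1..n}" using permutes_in_image[OF h] ka by blast
    then show "permute_index d n \<tau> j k a = (permute_index d n \<sigma> (j \<circ> g) \<circ> h) k a"
      using ka \<tau> by (simp add: permute_index_def)
  qed
qed

lemma perm_tensor_comp:
  assumes \<sigma>: "\<sigma> \<in> perm_tuples d n" and \<tau>: "\<tau> \<in> perm_tuples d n"
    and g: "g permutes {1..n}" and h: "h permutes {1..n}"
    and eq: "\<And>a. a \<in> {1..d} \<Longrightarrow> \<tau> a = g \<circ> \<sigma> a \<circ> h"
  shows "perm_tensor d n N \<sigma> (i, j \<circ> g) = perm_tensor d n N \<tau> (i \<circ> h, j)"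
proof (cases "j \<in> idx d n N")
  case True
  have inj: "i \<circ> h = i' \<circ> h \<longleftrightarrow> i = i'" for i' :: "nat \<Rightarrow> nat \<Rightarrow> nat"
  proof
    assume eq: "i \<circ> h = i' \<circ> h"
    show "i = i'"
    proof
      fix x
      show "i x = i' x"
        using fun_cong[OF eq, of "inv_into UNIV h x"] by (simp add: permutes_inverses(1)[OF h])
    qed
  qed simp
  show ?thesis
    using True tpower_index_comp[OF g, of j "U_index d N"] permute_index_comp[OF True \<sigma> \<tau> g h eq]
    by (simp add: perm_tensor_def inj)
next
  case False
  then show ?thesis using tpower_index_comp[OF g, of j "U_index d N"] by (simp add: perm_tensor_def)
qed

definition class_tensor :: "nat \<Rightarrow> nat \<Rightarrow> nat \<Rightarrow> (nat \<Rightarrow> nat \<Rightarrow> nat) set \<Rightarrow>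
    (nat \<Rightarrow> nat \<Rightarrow> nat) \<times> (nat \<Rightarrow> nat \<Rightarrow> nat) \<Rightarrow> complex" where
  "class_tensor d n N C x = (\<Sum>\<sigma>\<in>C. perm_tensor d n N \<sigma> x)"

lemma class_subset: "C \<in> perm_tuples d n // diag_rel d n \<Longrightarrow> C \<subseteq> perm_tuples d n"
  using Union_quotient[OF equiv_diag_rel[of d n]] by blast

text \<open>Relabelling rows by \<pi> and columns by \<rho> replaces each component
  \<open>\<sigma> a\<close> by \<rho> times it times the inverse of \<pi>, which only permutes the
  summands of a double coset.\<close>

lemma class_tensor_invariant:
  assumes C: "C \<in> perm_tuples d n // diag_rel d n"
  shows "class_tensor d n N C \<in> WWbar_invariants d n N"
  unfolding mem_WWbar_invariants_iff
proof
  note CP = subsetD[OF class_subset[OF C]]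
  show "commutes_unitary d n N (class_tensor d n N C)"
    unfolding commutes_unitary_def
    using commutes_kron_linear[of C d n N "perm_tensor d n N" _ "\<lambda>_. 1"] CP
    by (auto simp: class_tensor_def[abs_def] intro: commutes_perm_tensor)
  have "class_tensor d n N C (i \<circ> \<pi>, j \<circ> \<rho>) = class_tensor d n N C (i, j)"
    if \<pi>: "\<pi> permutes {1..n}" and \<rho>: "\<rho> permutes {1..n}" for i j \<pi> \<rho>
  proof -
    let ?p = "inv_into UNIV \<pi>" and ?r = "inv_into UNIV \<rho>"
    define \<phi> where "\<phi> g h \<sigma> = (\<lambda>a\<in>{1..d}. g \<circ> \<sigma> a \<circ> h)" for g h :: "nat \<Rightarrow> nat" and \<sigma> :: "nat \<Rightarrow> nat \<Rightarrow> nat"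
    have \<phi>: "\<phi> g h \<sigma> \<in> C" if \<sigma>: "\<sigma> \<in> C" and gh: "g permutes {1..n}" "h permutes {1..n}" for g h \<sigma>
    proof -
      have "\<phi> g h \<sigma> \<in> perm_tuples d n"
        using perm_tuples_permutes[OF CP[OF \<sigma>]]
        by (auto simp: \<phi>_def perm_tuples_def intro!: permutes_compose gh)
      then have "(\<sigma>, \<phi> g h \<sigma>) \<in> diag_rel d n"
        using CP[OF \<sigma>] gh by (auto simp: diag_rel_def \<phi>_def)
      then show ?thesis using in_quotient_imp_closed[OF equiv_diag_rel C \<sigma>] by blast
    qed
    have bij: "bij_betw (\<phi> \<rho> ?p) C C"
    proof (rule bij_betw_byWitness[where f' = "\<phi> ?r \<pi>"])
      have "\<phi> ?r \<pi> (\<phi> \<rho> ?p \<sigma>) = \<sigma>" "\<phi> \<rho> ?p (\<phi> ?r \<pi> \<sigma>) = \<sigma>" if "\<sigma> \<in> C" for \<sigma>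
      proof -
        have "\<sigma> \<in> extensional {1..d}" using CP[OF that] by (auto simp: perm_tuples_def PiE_def)
        then show "\<phi> ?r \<pi> (\<phi> \<rho> ?p \<sigma>) = \<sigma>" "\<phi> \<rho> ?p (\<phi> ?r \<pi> \<sigma>) = \<sigma>"
          by (auto simp: \<phi>_def fun_eq_iff permutes_inverses[OF \<pi>] permutes_inverses[OF \<rho>] extensional_def)
      qed
      then show "\<forall>\<sigma>\<in>C. \<phi> ?r \<pi> (\<phi> \<rho> ?p \<sigma>) = \<sigma>" "\<forall>\<sigma>\<in>C. \<phi> \<rho> ?p (\<phi> ?r \<pi> \<sigma>) = \<sigma>" by auto
      show "\<phi> \<rho> ?p ` C \<subseteq> C" using \<phi>[OF _ \<rho> permutes_inv[OF \<pi>]] by blast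
      show "\<phi> ?r \<pi> ` C \<subseteq> C" using \<phi>[OF _ permutes_inv[OF \<rho>] \<pi>] by blast
    qed
    have "perm_tensor d n N \<sigma> (i \<circ> \<pi>, j \<circ> \<rho>) = perm_tensor d n N (\<phi> \<rho> ?p \<sigma>) (i, j)" if \<sigma>: "\<sigma> \<in> C" for \<sigma>
    proof -
      have "perm_tensor d n N \<sigma> (i \<circ> \<pi>, j \<circ> \<rho>) = perm_tensor d n N (\<phi> \<rho> ?p \<sigma>) (i \<circ> \<pi> \<circ> ?p, j)"
        by (rule perm_tensor_comp[OF CP[OF \<sigma>] CP[OF \<phi>[OF \<sigma> \<rho> permutes_inv[OF \<pi>]]] \<rho> permutes_inv[OF \<pi>]])
           (simp add: \<phi>_def)
      also have "i \<circ> \<pi> \<circ> ?p = i" by (simp add: fun_eq_iff permutes_inverses[OF \<pi>])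
      finally show ?thesis .
    qed
    then have "class_tensor d n N C (i \<circ> \<pi>, j \<circ> \<rho>) = (\<Sum>\<sigma>\<in>C. perm_tensor d n N (\<phi> \<rho> ?p \<sigma>) (i, j))"
      by (simp add: class_tensor_def)
    also have "\<dots> = class_tensor d n N C (i, j)"
      unfolding class_tensor_def by (rule sum.reindex_bij_betw[OF bij])
    finally show ?thesis .
  qed
  moreover have "class_tensor d n N C x = 0" if "x \<notin> idx d n N \<times> idx d n N" for x
  proof -
    have "perm_tensor d n N \<sigma> x = 0" if "\<sigma> \<in> C" for \<sigma>
      using permute_index_in_idx[OF CP[OF that]] \<open>x \<notin> _\<close> by (cases x) (auto simp: perm_tensor_def)
    then show ?thesis by (simp add: class_tensor_def)
  qed
  ultimately show "bisymmetric d n N (class_tensor d n N C)"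
    unfolding bisymmetric_def coord_space_def by blast
qed

lemma class_tensor_at:
  assumes C: "C \<in> perm_tuples d n // diag_rel d n" and \<tau>: "\<tau> \<in> perm_tuples d n" and nN: "n \<le> N"
  shows "class_tensor d n N C (permute_index d n \<tau> (base_index d n), base_index d n) = (if \<tau> \<in> C then 1 else 0)"
proof -
  note CP = subsetD[OF class_subset[OF C]]
  have finC: "finite C" using finite_subset[OF class_subset[OF C] finite_perm_tuples] .
  have "class_tensor d n N C (permute_index d n \<tau> (base_index d n), base_index d n) = (\<Sum>\<sigma>\<in>C. if \<sigma> = \<tau> then 1 else 0)"
    unfolding class_tensor_def
  proof (rule sum.cong[OF refl])
    fix \<sigma> assume "\<sigma> \<in> C"
    show "perm_tensor d n N \<sigma> (permute_index d n \<tau> (base_index d n), base_index d n) = (if \<sigma> = \<tau> then 1 else 0)"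
      by (rule perm_tensor_at_injective[OF CP[OF \<open>\<sigma> \<in> C\<close>] \<tau> base_index_in_idx[OF nN] inj_on_base_index])
  qed
  then show ?thesis using finC by simp
qed

text \<open>Symmetry removes \<open>h\<close> from the row and moves the column from the base index
  to \<open>?b \<circ> g\<close>. That column still has distinct entries, so the expansion evaluated
  there returns the coefficient of \<sigma>.\<close>

lemma invariant_coefficient_class_function:
  assumes T: "T \<in> WWbar_invariants d n N" and nN: "n \<le> N" and rel: "(\<sigma>, \<tau>) \<in> diag_rel d n"
  shows "T (permute_index d n \<tau> (base_index d n), base_index d n) =
    T (permute_index d n \<sigma> (base_index d n), base_index d n)"
proof -
  let ?b = "base_index d n" and ?P = "perm_tuples d n"
  note b = base_index_in_idx[OF nN, of d]
  have bi: "bisymmetric d n N T" and com: "commutes_unitary d n N T"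
    using T by (auto simp: mem_WWbar_invariants_iff)
  then have coord: "T \<in> coord_space (idx d n N \<times> idx d n N)" by (simp add: bisymmetric_def)
  obtain g h where \<sigma>: "\<sigma> \<in> ?P" and \<tau>: "\<tau> \<in> ?P" and g: "g permutes {1..n}" and h: "h permutes {1..n}"
    and eq: "\<And>a. a \<in> {1..d} \<Longrightarrow> \<tau> a = g \<circ> \<sigma> a \<circ> h"
    using rel by (auto simp: diag_rel_def)
  have bg: "?b \<circ> g \<in> idx d n N" using b tpower_index_comp[OF g] by blast
  have inj: "inj_on (\<lambda>k. (?b \<circ> g) k a) {1..n}" if a: "a \<in> {1..d}" for a
  proof (rule inj_onI)
    fix x y assume xy: "x \<in> {1..n}" "y \<in> {1..n}" "(?b \<circ> g) x a = (?b \<circ> g) y a"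
    have "g x \<in> {1..n}" "g y \<in> {1..n}" using permutes_in_image[OF g] xy by blast+
    then have "g x = g y" using inj_onD[OF inj_on_base_index[OF a]] xy(3) by (simp only: comp_apply)
    then show "x = y" using permutes_inj[OF g] by (simp add: inj_eq)
  qed
  have "T (permute_index d n \<tau> ?b, ?b) = T (permute_index d n \<sigma> (?b \<circ> g) \<circ> h, ?b \<circ> id)"
    by (simp only: permute_index_comp[OF b \<sigma> \<tau> g h eq] comp_id)
  also have "\<dots> = T (permute_index d n \<sigma> (?b \<circ> g), ?b)"
    using bi h permutes_id unfolding bisymmetric_def by blast
  also have "\<dots> = T (permute_index d n \<sigma> (?b \<circ> g) \<circ> id, ?b \<circ> g)"
    using bi g permutes_id unfolding bisymmetric_def by metis
  also have "\<dots> = T (permute_index d n \<sigma> (?b \<circ> g), ?b \<circ> g)" by simp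
  also have "\<dots> = (\<Sum>\<rho>\<in>?P. T (permute_index d n \<rho> ?b, ?b) *
      perm_tensor d n N \<rho> (permute_index d n \<sigma> (?b \<circ> g), ?b \<circ> g))"
    by (rule commutes_unitary_expansion[OF com coord nN])
  also have "\<dots> = (\<Sum>\<rho>\<in>?P. if \<rho> = \<sigma> then T (permute_index d n \<rho> ?b, ?b) else 0)"
  proof (rule sum.cong[OF refl])
    fix \<rho> assume "\<rho> \<in> ?P"
    then have "perm_tensor d n N \<rho> (permute_index d n \<sigma> (?b \<circ> g), ?b \<circ> g) = (if \<rho> = \<sigma> then 1 else 0)"
      by (rule perm_tensor_at_injective[OF _ \<sigma> bg inj])
    then show "T (permute_index d n \<rho> ?b, ?b) * perm_tensor d n N \<rho> (permute_index d n \<sigma> (?b \<circ> g), ?b \<circ> g) =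
        (if \<rho> = \<sigma> then T (permute_index d n \<rho> ?b, ?b) else 0)" by simp
  qed
  also have "\<dots> = T (permute_index d n \<sigma> ?b, ?b)" using \<sigma> by (simp add: finite_perm_tuples)
  finally show ?thesis .
qed

text \<open>The class tensors form a basis, one per double coset: evaluation at representatives
  gives independence, and grouping the expansion of an invariant by classes gives spanning.\<close>

theorem dim_WWbar_invariants:
  assumes nN: "n \<le> N"
  shows "cvec.dim (WWbar_invariants d n N) = Z_count d n"
proof (rule cvec.dim_unique)
  let ?b = "base_index d n" and ?P = "perm_tuples d n" and ?Q = "perm_tuples d n // diag_rel d n"
  let ?F = "class_tensor d n N"
  note equiv = equiv_diag_rel[of d n]
  have finQ: "finite ?Q" by (rule finite_quotient[OF finite_perm_tuples]) (auto simp: diag_rel_def)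
  define r where "r C = (SOME \<sigma>. \<sigma> \<in> C)" for C :: "(nat \<Rightarrow> nat \<Rightarrow> nat) set"
  have r: "r C \<in> C" if "C \<in> ?Q" for C
    unfolding r_def using in_quotient_imp_non_empty[OF equiv that] by (simp add: some_in_eq)
  have rP: "r C \<in> ?P" if "C \<in> ?Q" for C using r[OF that] class_subset[OF that] by blast
  \<comment> \<open>These points form a dual system: \<open>?F C\<close> is \<open>1\<close> at the
    point of \<open>C\<close> and \<open>0\<close> at those of the other classes.\<close>
  define ev where "ev C = (permute_index d n (r C) ?b, ?b)" for C
  have Fev: "?F C (ev C') = (if C = C' then 1 else 0)" if "C \<in> ?Q" "C' \<in> ?Q" for C C'
  proof -
    have "r C' \<in> C \<longleftrightarrow> C = C'"
      using quotient_disj[OF equiv that] r[OF that(2)] by blast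
    then show ?thesis unfolding ev_def by (simp only: class_tensor_at[OF that(1) rP[OF that(2)] nN])
  qed
  have inj: "inj_on ?F ?Q"
  proof (rule inj_onI)
    fix C C' assume "C \<in> ?Q" "C' \<in> ?Q" "?F C = ?F C'"
    then show "C = C'" using Fev[of C C] Fev[of C' C] by (metis zero_neq_one)
  qed
  show "?F ` ?Q \<subseteq> WWbar_invariants d n N" using class_tensor_invariant by blast
  show "cvec.independent (?F ` ?Q)"
  proof (rule cvec.independent_if_scalars_zero)
    show "finite (?F ` ?Q)" using finQ by simp
    fix f x assume sum0: "(\<Sum>x\<in>?F ` ?Q. cscale (f x) x) = 0" and "x \<in> ?F ` ?Q"
    then obtain C where C: "C \<in> ?Q" "x = ?F C" by blast
    have "0 = (\<Sum>x\<in>?F ` ?Q. cscale (f x) x) (ev C)" by (simp add: sum0)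
    also have "\<dots> = (\<Sum>C'\<in>?Q. f (?F C') * ?F C' (ev C))"
      by (simp add: sum_fun_apply sum.reindex[OF inj] cscale_def)
    also have "\<dots> = (\<Sum>C'\<in>?Q. if C' = C then f (?F C') else 0)"
      by (rule sum.cong) (simp_all add: Fev C(1))
    also have "\<dots> = f x" using C finQ by simp
    finally show "f x = 0" ..
  qed
  show "card (?F ` ?Q) = Z_count d n" by (simp add: card_image[OF inj] Z_count_def)
  show "WWbar_invariants d n N \<subseteq> cvec.span (?F ` ?Q)"
  proof
    fix T assume T: "T \<in> WWbar_invariants d n N"
    then have com: "commutes_unitary d n N T" and coord: "T \<in> coord_space (idx d n N \<times> idx d n N)"
      by (auto simp: mem_WWbar_invariants_iff bisymmetric_def)
    have expand: "T x = (\<Sum>C\<in>?Q. T (ev C) * ?F C x)" for x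
    proof -
      let ?c = "\<lambda>\<sigma>. T (permute_index d n \<sigma> ?b, ?b)"
      have "T x = (\<Sum>\<sigma>\<in>\<Union>?Q. ?c \<sigma> * perm_tensor d n N \<sigma> x)"
        unfolding Union_quotient[OF equiv] by (rule commutes_unitary_expansion[OF com coord nN])
      also have "\<dots> = (\<Sum>C\<in>?Q. \<Sum>\<sigma>\<in>C. ?c \<sigma> * perm_tensor d n N \<sigma> x)"
      proof (rule sum.Union_disjoint[unfolded comp_def])
        show "\<forall>C\<in>?Q. finite C"
          using finite_subset[OF class_subset finite_perm_tuples] by blast
        show "\<forall>A\<in>?Q. \<forall>B\<in>?Q. A \<noteq> B \<longrightarrow> A \<inter> B = {}"
          using quotient_disj[OF equiv] by blast
      qed
      also have "\<dots> = (\<Sum>C\<in>?Q. T (ev C) * ?F C x)"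
      proof (rule sum.cong[OF refl])
        fix C assume C: "C \<in> ?Q"
        have "?c \<sigma> = T (ev C)" if "\<sigma> \<in> C" for \<sigma>
          unfolding ev_def
          by (rule invariant_coefficient_class_function[OF T nN quotient_eq_iff[OF equiv C C r[OF C] that, THEN iffD1, OF refl]])
        then show "(\<Sum>\<sigma>\<in>C. ?c \<sigma> * perm_tensor d n N \<sigma> x) = T (ev C) * ?F C x"
          by (simp add: class_tensor_def sum_distrib_left)
      qed
      finally show ?thesis .
    qed
    have "T = (\<Sum>C\<in>?Q. cscale (T (ev C)) (?F C))"
      by (intro ext, unfold sum_fun_apply cscale_def) (rule expand)
    also have "\<dots> \<in> cvec.span (?F ` ?Q)"
      by (intro cvec.span_sum cvec.span_scale cvec.span_base) auto
    finally show "T \<in> cvec.span (?F ` ?Q)" .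
  qed
qed

theorem mainTheorem1:
  fixes d n :: nat
  assumes "d \<ge> 2" and "n \<ge> 1"
  shows "Z_count d n = (\<Sum>p\<in>partitions n. Sym n p ^ (d - 2)) \<and>
    (\<forall>N>n. Z_count d n = cvec.dim (WWbar_invariants d n N))"
  using Z_count_eq_sum_partitions[OF assms(1)] dim_WWbar_invariants by simp

end
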